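(* Let $0\le i\le m\le n$ and let $\Delta_\succ$ be the reverse lexicographic triangulation of $\mathcal P(m,n)=\{e_a\oplus f_b:1\le a\le m,\,1\le b\le n\}\subset\mathbb R^m\oplus\mathbb R^n$ with respect to a total order of the points (identified with variables $x_{ab}\leftrightarrow e_a\oplus f_b$) in which $x_{11}\prec x_{22}\prec\cdots\prec x_{ii}$ and all remaining variables are larger than $x_{ii}$. After removing the cone points $x_{11},\dots,x_{ii}$ from $\Delta_\succ$, the remaining simplicial complex is an $(m+n-i-2)$-dimensional ball if $m<n$, or if $m=n$ and $i<m$; and it is an $(n-2)$-dimensional sphere if $i=m=n$.
   Context: $e_a$, $f_b$ are standard unit vectors. Reverse lexicographic triangulation of a point configuration $\mathcal A=\{a_1\succ\cdots\succ a_N\}$: if $F_1,\dots,F_k$ are the facets of $\operatorname{conv}(\mathcal A)$ not containing $a_N$, the maximal simplices of $\Delta_\succ(\mathcal A)$ are the sets $G\cup\{a_N\}$ with $G$ a maximal simplex of $\Delta_\succ(\mathcal A\cap F_i)$ (recursively, with the induced order). Removing vertices $v_1,\dots,v_r$ that are cone points (lie in every facet) means passing to the complex of faces not containing any $v_j$ (restriction to the other vertices); balls and spheres are understood up to homeomorphism of geometric realizations. *)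

theory Defs
  imports "HOL-Analysis.Analysis"
begin

text \<open>A point configuration is a finite set A of labels together with coordinates
  p :: label => (nat => real) (finitely supported). Affine independence of a finite
  family of points:\<close>

definition aff_indep :: "('v \<Rightarrow> nat \<Rightarrow> real) \<Rightarrow> 'v set \<Rightarrow> bool" where
  "aff_indep p T \<longleftrightarrow> finite T \<and>
     (\<forall>c. (\<Sum>v\<in>T. c v) = 0 \<and> (\<forall>k. (\<Sum>v\<in>T. c v * p v k) = 0) \<longrightarrow> (\<forall>v\<in>T. c v = 0))"

definition adim :: "('v \<Rightarrow> nat \<Rightarrow> real) \<Rightarrow> 'v set \<Rightarrow> int" where
  "adim p S = (if S = {} then -1 else int (Max {card T | T. T \<subseteq> S \<and> aff_indep p T}) - 1)"

text \<open>Faces of the polytope conv(p ` A), recorded by the points of A they contain: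
  S is (the point set of) a face if there is a linear functional (with finite support K,
  coefficients w) and a constant c with functional <= c on A and equality exactly on S.
  A facet is a nonempty face of affine dimension one less than conv(p ` A).\<close>

definition lin_fun :: "(nat \<Rightarrow> real) \<Rightarrow> nat set \<Rightarrow> (nat \<Rightarrow> real) \<Rightarrow> real" where
  "lin_fun w K x = (\<Sum>k\<in>K. w k * x k)"

definition face_pts :: "('v \<Rightarrow> nat \<Rightarrow> real) \<Rightarrow> 'v set \<Rightarrow> 'v set \<Rightarrow> bool" where
  "face_pts p A S \<longleftrightarrow> (\<exists>w K c. finite K \<and> (\<forall>v\<in>A. lin_fun w K (p v) \<le> c) \<and>
                                 S = {v\<in>A. lin_fun w K (p v) = c})"

definition facet_pts :: "('v \<Rightarrow> nat \<Rightarrow> real) \<Rightarrow> 'v set \<Rightarrow> 'v set \<Rightarrow> bool" where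
  "facet_pts p A S \<longleftrightarrow> face_pts p A S \<and> S \<noteq> {} \<and> adim p S = adim p A - 1"

text \<open>The total order is given by a rank function r (injective on the configuration):
  u \<prec> v iff r u < r v. Writing A = {a_1 \<succ> ... \<succ> a_N}, a_N is the r-minimal element.
  revlex_max p r A G means: G is a maximal simplex of the reverse lexicographic
  triangulation of A.\<close>

inductive revlex_max :: "('v \<Rightarrow> nat \<Rightarrow> real) \<Rightarrow> ('v \<Rightarrow> nat) \<Rightarrow> 'v set \<Rightarrow> 'v set \<Rightarrow> bool"
  for p r where
  single: "revlex_max p r {v} {v}"
| cone: "\<lbrakk> finite A; v \<in> A; \<forall>u\<in>A. r v \<le> r u; facet_pts p A S; v \<notin> S;
           revlex_max p r S G \<rbrakk> \<Longrightarrow> revlex_max p r A (insert v G)"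

definition complex_of_max :: "'v set set \<Rightarrow> 'v set set" where
  "complex_of_max M = {F. \<exists>G\<in>M. F \<subseteq> G}"

definition revlex_tri :: "('v \<Rightarrow> nat \<Rightarrow> real) \<Rightarrow> ('v \<Rightarrow> nat) \<Rightarrow> 'v set \<Rightarrow> 'v set set" where
  "revlex_tri p r A = complex_of_max {G. revlex_max p r A G}"

definition remove_cone_points :: "'v set set \<Rightarrow> 'v set \<Rightarrow> 'v set set" where
  "remove_cone_points K C = {F \<in> K. F \<inter> C = {}}"

text \<open>Standard geometric realization of an abstract simplicial complex K, vertices sent
  (via an injective index map idx) to standard basis vectors of R^\<omega> = nat => real,
  with the (product = Euclidean on finitely many coordinates) topology.\<close>

definition geom_real :: "('v \<Rightarrow> nat) \<Rightarrow> 'v set set \<Rightarrow> (nat \<Rightarrow> real) set" where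
  "geom_real idx K = {x. \<exists>F\<in>K. (\<forall>k. 0 \<le> x k) \<and> (\<forall>k. k \<notin> idx ` F \<longrightarrow> x k = 0)
                                 \<and> (\<Sum>k\<in>idx ` F. x k) = 1}"

definition real_top :: "('v \<Rightarrow> nat) \<Rightarrow> 'v set set \<Rightarrow> (nat \<Rightarrow> real) topology" where
  "real_top idx K = subtopology (powertop_real UNIV) (geom_real idx K)"

definition ball_top :: "nat \<Rightarrow> (nat \<Rightarrow> real) topology" where
  "ball_top d = subtopology (Euclidean_space d) {x. (\<Sum>k<d. (x k)\<^sup>2) \<le> 1}"

definition Pmn :: "nat \<Rightarrow> nat \<Rightarrow> (nat \<times> nat) set" where
  "Pmn m n = {(a, b). 1 \<le> a \<and> a \<le> m \<and> 1 \<le> b \<and> b \<le> n}"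

text \<open>e_a \<oplus> f_b in R^m \<oplus> R^n: coordinates 0..m-1 for R^m, m..m+n-1 for R^n.\<close>

definition pt :: "nat \<Rightarrow> nat \<times> nat \<Rightarrow> nat \<Rightarrow> real" where
  "pt m = (\<lambda>(a, b) k. (if k = a - 1 then 1 else 0) + (if k = m + (b - 1) then 1 else 0))"

definition vidx :: "nat \<Rightarrow> nat \<times> nat \<Rightarrow> nat" where
  "vidx n = (\<lambda>(a, b). (a - 1) * n + (b - 1))"

end

theory Submission
  imports Defs
begin

text \<open>Pulling the vertex \<open>(a, b)\<close> of \<open>\<Delta>\<^sub>I \<times> \<Delta>\<^sub>J\<close> leaves the facets in which row \<open>a\<close> or column \<open>b\<close> is
  deleted. Hence the weights of a point \<open>(x, y)\<close> in the reverse lexicographic triangulation are found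
  greedily: run through the vertices in increasing order and give \<open>(a, b)\<close> the smaller of what remains of
  \<open>x\<^sub>a\<close> and \<open>y\<^sub>b\<close>. Taking marginals therefore identifies the realization of the complex without the first
  \<open>i\<close> diagonal vertices with the set of pairs of probability vectors \<open>(x, y)\<close> such that
  \<open>x\<^sub>k y\<^sub>k = 0\<close> for \<open>k \<le> i\<close>. Replacing the pair \<open>(x\<^sub>k, y\<^sub>k)\<close> by the single real number \<open>x\<^sub>k - y\<^sub>k\<close> for
  \<open>k \<le> i\<close> turns this set into the \<open>\<ell>\<^sup>1\<close>-sphere of radius 2 inside a closed convex cone of dimension
  \<open>m + n - i - 1\<close>. The cone is a linear space if \<open>i = m = n\<close>, and the section is then a sphere;
  otherwise it is not, and the section is a ball.\<close>

section \<open>Facets of a product of simplices\<close>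

text \<open>Gaussian elimination, one equation per induction step: a pivot variable is eliminated
  along with its equation, so the surplus of variables persists.\<close>

lemma homogeneous_system_nontrivial_solution:
  fixes M :: "'e \<Rightarrow> 'v \<Rightarrow> real"
  assumes "finite E" "finite T" "card E < card T"
  shows "\<exists>c. (\<exists>v\<in>T. c v \<noteq> 0) \<and> (\<forall>e\<in>E. (\<Sum>v\<in>T. c v * M e v) = 0)"
  using assms
proof (induction E arbitrary: T M rule: finite_induct)
  case empty
  then obtain v where "v \<in> T" by fastforce
  then show ?case by (intro exI[of _ "\<lambda>_. 1"]) auto
next
  case (insert e E)
  show ?case
  proof (cases "\<forall>v\<in>T. M e v = 0")
    case True
    have "card E < card T" using insert by simp
    from insert.IH[OF insert.prems(1) this, of M] obtain c where
      "\<exists>v\<in>T. c v \<noteq> 0" "\<forall>e\<in>E. (\<Sum>v\<in>T. c v * M e v) = 0" by blast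
    then show ?thesis using True by (intro exI[of _ c]) auto
  next
    case False
    then obtain u where u: "u \<in> T" "M e u \<noteq> 0" by blast
    \<comment> \<open>Row \<open>f\<close> minus the multiple of row \<open>e\<close> that clears
      its entry at the pivot \<open>u\<close>.\<close>
    define N where "N = (\<lambda>f v. M f v - M f u * M e v / M e u)"
    have "card E < card (T - {u})" using insert u by simp
    from insert.IH[OF _ this, of N] obtain c where
      c: "\<exists>v\<in>T-{u}. c v \<noteq> 0" "\<forall>f\<in>E. (\<Sum>v\<in>T-{u}. c v * N f v) = 0"
      using insert.prems by auto
    define s where "s = (\<Sum>v\<in>T-{u}. c v * M e v)"
    \<comment> \<open>The value at \<open>u\<close> is the one that solves equation
      \<open>e\<close>.\<close>
    define c' where "c' = c(u := - s / M e u)"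
    have eq: "(\<Sum>v\<in>T. c' v * M f v) = - s / M e u * M f u + (\<Sum>v\<in>T-{u}. c v * M f v)" for f
    proof -
      have "(\<Sum>v\<in>T. c' v * M f v) = c' u * M f u + (\<Sum>v\<in>T-{u}. c' v * M f v)"
        using u insert.prems by (simp add: sum.remove)
      moreover have "(\<Sum>v\<in>T-{u}. c' v * M f v) = (\<Sum>v\<in>T-{u}. c v * M f v)"
        by (rule sum.cong) (auto simp: c'_def)
      ultimately show ?thesis by (simp add: c'_def)
    qed
    have "(\<Sum>v\<in>T. c' v * M e v) = 0" using u by (simp add: eq s_def)
    moreover have "(\<Sum>v\<in>T. c' v * M f v) = 0" if "f \<in> E" for f
    proof -
      have "(\<Sum>v\<in>T-{u}. c v * N f v) = (\<Sum>v\<in>T-{u}. c v * M f v) - s * (M f u / M e u)"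
        unfolding s_def sum_distrib_right sum_subtractf[symmetric]
        by (rule sum.cong) (auto simp: N_def algebra_simps)
      then show ?thesis using c(2) that by (simp add: eq)
    qed
    moreover have "\<exists>v\<in>T. c' v \<noteq> 0" using c(1) by (auto simp: c'_def)
    ultimately show ?thesis by auto
  qed
qed

text \<open>An affine dependence is a weighting with zero row and column sums. These are
  \<open>card I + card J\<close> equations with one redundancy, which bounds independent sets by
  \<open>card I + card J - 1\<close>; a hook of one full row and one full column attains the
  bound.\<close>

lemma adim_product:
  assumes I: "finite I" "I \<noteq> {}" "I \<subseteq> {1..m}" and J: "finite J" "J \<noteq> {}" "J \<subseteq> {1..}"
  shows "adim (pt m) (I \<times> J) = int (card I) + int (card J) - 2"
proof -
  obtain a0 b0 where ab: "a0 \<in> I" "b0 \<in> J" using I J by blast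
  have rng: "1 \<le> fst v" "fst v \<le> m" "1 \<le> snd v" if "v \<in> I \<times> J" for v
    using that I(3) J(3) by auto
  have upper: "card T \<le> card I + card J - 1" if T: "T \<subseteq> I \<times> J" "aff_indep (pt m) T" for T
  proof (rule ccontr)
    assume big: "\<not> card T \<le> card I + card J - 1"
    \<comment> \<open>Column \<open>b0\<close> is left out: its sum follows from the total, which
      the row sums already force to be 0.\<close>
    define E where "E = Inl ` I \<union> Inr ` (J - {b0})"
    have fT: "finite T" using T(2) by (simp add: aff_indep_def)
    have "card E = card I + (card J - 1)"
      unfolding E_def using I J ab
      by (subst card_Un_disjoint) (auto simp: card_image)
    moreover have "card J > 0" using J by (simp add: card_gt_0_iff)
    ultimately have cE: "card E < card T" using big by linarith
    have fE: "finite E" unfolding E_def using I J by auto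
    obtain c :: "nat \<times> nat \<Rightarrow> real" where c: "\<exists>v\<in>T. c v \<noteq> 0"
      "\<forall>e\<in>E. (\<Sum>v\<in>T. c v * (case e of Inl a \<Rightarrow> of_bool (fst v = a) | Inr b \<Rightarrow> of_bool (snd v = b))) = 0"
      using homogeneous_system_nontrivial_solution[OF fE fT cE,
        of "\<lambda>e v. case e of Inl a \<Rightarrow> of_bool (fst v = a) | Inr b \<Rightarrow> of_bool (snd v = b)"] by blast
    have row: "(\<Sum>v\<in>T. c v * of_bool (fst v = a)) = 0" for a
    proof (cases "a \<in> I")
      case True then show ?thesis using bspec[OF c(2), of "Inl a"] by (simp add: E_def)
    next
      case False
      then show ?thesis using T(1) by (intro sum.neutral) auto
    qed
    have tot: "(\<Sum>v\<in>T. c v) = 0"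
    proof -
      have "(\<Sum>v\<in>T. c v) = (\<Sum>v\<in>T. \<Sum>a\<in>I. c v * of_bool (fst v = a))"
        using T(1) I(1) by (intro sum.cong) (auto simp: sum_distrib_left[symmetric] of_bool_def sum.delta')
      also have "\<dots> = (\<Sum>a\<in>I. \<Sum>v\<in>T. c v * of_bool (fst v = a))" by (rule sum.swap)
      finally show ?thesis by (simp add: row)
    qed
    have col: "(\<Sum>v\<in>T. c v * of_bool (snd v = b)) = 0" for b
    proof -
      have 1: "(\<Sum>v\<in>T. c v * of_bool (snd v = b)) = 0" if "b \<noteq> b0" for b
      proof (cases "b \<in> J")
        case True then show ?thesis using bspec[OF c(2), of "Inr b"] that by (simp add: E_def)
      next
        case False
        then show ?thesis using T(1) by (intro sum.neutral) auto
      qed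
      have "(\<Sum>v\<in>T. c v) = (\<Sum>v\<in>T. \<Sum>b\<in>J. c v * of_bool (snd v = b))"
        using T(1) J(1) by (intro sum.cong) (auto simp: sum_distrib_left[symmetric] of_bool_def sum.delta')
      also have "\<dots> = (\<Sum>b\<in>J. \<Sum>v\<in>T. c v * of_bool (snd v = b))" by (rule sum.swap)
      also have "\<dots> = (\<Sum>v\<in>T. c v * of_bool (snd v = b0))"
        using ab J(1) 1 by (subst sum.remove[of _ b0]) auto
      finally show ?thesis using 1 tot by (cases "b = b0") auto
    qed
    have "(\<Sum>v\<in>T. c v * pt m v k) = 0" for k
    proof -
      \<comment> \<open>The factor \<open>of_bool (k \<ge> m)\<close> guards the truncated
        subtraction \<open>k - m\<close>.\<close>
      have "c v * pt m v k = c v * of_bool (fst v = k + 1) + c v * of_bool (k \<ge> m) * of_bool (snd v = k - m + 1)"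
        if "v \<in> T" for v
      proof -
        have "v \<in> I \<times> J" using that T(1) by blast
        from rng[OF this] show ?thesis by (cases v) (auto simp: pt_def algebra_simps)
      qed
      then have "(\<Sum>v\<in>T. c v * pt m v k) =
         (\<Sum>v\<in>T. c v * of_bool (fst v = k + 1) + c v * of_bool (k \<ge> m) * of_bool (snd v = k - m + 1))"
        by (intro sum.cong) auto
      also have "\<dots> = 0" using row[of "k+1"] col[of "k-m+1"] by (cases "k \<ge> m") (simp_all add: sum.distrib)
      finally show ?thesis .
    qed
    then show False using T(2) tot c(1) unfolding aff_indep_def by blast
  qed
  \<comment> \<open>The hook with corner \<open>(a0, b0)\<close>. Any other point of it is alone in
    its row or in its column, so one coordinate isolates its coefficient; the corner is then settled
    by the zero sum.\<close>
  define S where "S = {a0} \<times> J \<union> (I - {a0}) \<times> {b0}"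
  have fS: "finite S" using I J by (auto simp: S_def)
  have S: "S \<subseteq> I \<times> J" using ab by (auto simp: S_def)
  have cS: "card S = card I + card J - 1"
  proof -
    have "card S = card J + (card I - 1)"
      unfolding S_def using I J ab by (subst card_Un_disjoint) (auto simp: card_cartesian_product)
    moreover have "card I > 0" using I by (simp add: card_gt_0_iff)
    ultimately show ?thesis by simp
  qed
  have "aff_indep (pt m) S"
    unfolding aff_indep_def
  proof (intro conjI allI impI fS)
    fix c assume c: "sum c S = 0 \<and> (\<forall>k. (\<Sum>v\<in>S. c v * pt m v k) = 0)"
    have 1: "c (a, b0) = 0" if "a \<in> I" "a \<noteq> a0" for a
    proof -
      have "c v * pt m v (a - 1) = (if v = (a, b0) then c v else 0)" if "v \<in> S" for v
      proof -
        have "v \<in> I \<times> J" "(a, b0) \<in> I \<times> J" using that \<open>a \<in> I\<close> S ab by blast+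
        then have "pt m v (a - 1) = of_bool (fst v = a)"
          using rng[of v] rng[of "(a, b0)"] by (cases v) (auto simp: pt_def)
        then show ?thesis using that \<open>a \<noteq> a0\<close> by (auto simp: S_def)
      qed
      then have "(\<Sum>v\<in>S. c v * pt m v (a - 1)) = (\<Sum>v\<in>S. if v = (a, b0) then c v else 0)"
        by (intro sum.cong) auto
      also have "\<dots> = c (a, b0)" using fS that by (simp add: sum.delta) (simp add: S_def)
      finally show ?thesis using c by simp
    qed
    have 2: "c (a0, b) = 0" if "b \<in> J" "b \<noteq> b0" for b
    proof -
      have "c v * pt m v (m + (b - 1)) = (if v = (a0, b) then c v else 0)" if "v \<in> S" for v
      proof -
        have "v \<in> I \<times> J" "(a0, b) \<in> I \<times> J" using that \<open>b \<in> J\<close> S ab by blast+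
        then have "pt m v (m + (b - 1)) = of_bool (snd v = b)"
          using rng[of v] rng[of "(a0, b)"] by (cases v) (auto simp: pt_def)
        then show ?thesis using that \<open>b \<noteq> b0\<close> by (auto simp: S_def)
      qed
      then have "(\<Sum>v\<in>S. c v * pt m v (m + (b - 1))) = (\<Sum>v\<in>S. if v = (a0, b) then c v else 0)"
        by (intro sum.cong) auto
      also have "\<dots> = c (a0, b)" using fS that by (simp add: sum.delta) (simp add: S_def)
      finally show ?thesis using c by simp
    qed
    have in0: "(a0, b0) \<in> S" using ab by (simp add: S_def)
    have "(\<Sum>v\<in>S - {(a0, b0)}. c v) = 0"
      by (rule sum.neutral) (use 1 2 in \<open>auto simp: S_def\<close>)
    then have "c (a0, b0) = 0" using c fS in0 by (simp add: sum.remove)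
    then show "\<forall>v\<in>S. c v = 0" using 1 2 by (auto simp: S_def)
  qed
  then have "card I + card J - 1 \<in> {card T | T. T \<subseteq> I \<times> J \<and> aff_indep (pt m) T}"
    using S cS[symmetric] by blast
  moreover have le: "k \<le> card I + card J - 1" if "k \<in> {card T | T. T \<subseteq> I \<times> J \<and> aff_indep (pt m) T}" for k
    using that upper by blast
  moreover have "finite {card T | T. T \<subseteq> I \<times> J \<and> aff_indep (pt m) T}"
    by (rule finite_subset[of _ "{..card I + card J - 1}"]) (use le in blast, simp)
  ultimately have "Max {card T | T. T \<subseteq> I \<times> J \<and> aff_indep (pt m) T} = card I + card J - 1"
    by (intro Max_eqI)
  moreover have "card I > 0" "card J > 0" using I J by (simp_all add: card_gt_0_iff)
  ultimately show ?thesis using ab unfolding adim_def by auto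
qed

text \<open>On the points a linear functional splits as \<open>\<alpha> a + \<beta> b\<close>, and
  such a sum is maximal exactly where both summands are.\<close>

lemma face_pts_product:
  assumes "face_pts (pt m) (I \<times> J) S" "S \<noteq> {}"
  obtains I' J' where "I' \<subseteq> I" "J' \<subseteq> J" "S = I' \<times> J'"
proof -
  obtain w K c where K: "finite K" and le: "\<forall>v\<in>I \<times> J. lin_fun w K (pt m v) \<le> c"
    and S: "S = {v\<in>I \<times> J. lin_fun w K (pt m v) = c}"
    using assms(1) unfolding face_pts_def by blast
  define \<alpha> where "\<alpha> = (\<lambda>a. \<Sum>k\<in>K. w k * (if k = a - 1 then 1 else 0))"
  define \<beta> where "\<beta> = (\<lambda>b. \<Sum>k\<in>K. w k * (if k = m + (b - 1) then 1 else 0))"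
  have lf: "lin_fun w K (pt m (a, b)) = \<alpha> a + \<beta> b" for a b
    unfolding lin_fun_def pt_def \<alpha>_def \<beta>_def sum.distrib[symmetric]
    by (rule sum.cong) (auto simp: algebra_simps)
  obtain a0 b0 where ab: "a0 \<in> I" "b0 \<in> J" "\<alpha> a0 + \<beta> b0 = c" using assms(2) S lf by auto
  have a: "\<alpha> a \<le> \<alpha> a0" if "a \<in> I" for a using le ab that lf by force
  have b: "\<beta> b \<le> \<beta> b0" if "b \<in> J" for b using le ab that lf by force
  have "S = {a\<in>I. \<alpha> a = \<alpha> a0} \<times> {b\<in>J. \<beta> b = \<beta> b0}"
  proof (intro set_eqI iffI)
    fix v assume "v \<in> S"
    then show "v \<in> {a\<in>I. \<alpha> a = \<alpha> a0} \<times> {b\<in>J. \<beta> b = \<beta> b0}"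
      using a[of "fst v"] b[of "snd v"] ab(3) by (cases v) (auto simp: S lf)
  qed (use ab in \<open>auto simp: S lf\<close>)
  then show ?thesis by (intro that) auto
qed

text \<open>By the dimension formula, a face of codimension one loses exactly one element from
  exactly one factor. The conditions \<open>I \<noteq> {a}\<close> and \<open>J \<noteq> {b}\<close>
  keep the face nonempty.\<close>

lemma facet_pts_product:
  assumes I: "finite I" "I \<noteq> {}" "I \<subseteq> {1..m}" and J: "finite J" "J \<noteq> {}" "J \<subseteq> {1..}"
  shows "facet_pts (pt m) (I \<times> J) S \<longleftrightarrow>
    (\<exists>a\<in>I. I \<noteq> {a} \<and> S = (I - {a}) \<times> J) \<or> (\<exists>b\<in>J. J \<noteq> {b} \<and> S = I \<times> (J - {b}))"
proof
  assume f: "facet_pts (pt m) (I \<times> J) S"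
  then obtain I' J' where s: "I' \<subseteq> I" "J' \<subseteq> J" "S = I' \<times> J'"
    unfolding facet_pts_def by (metis face_pts_product)
  have ne: "I' \<noteq> {}" "J' \<noteq> {}" using f s by (auto simp: facet_pts_def)
  have fin: "finite I'" "finite J'" using finite_subset[OF s(1) I(1)] finite_subset[OF s(2) J(1)] .
  have "adim (pt m) S = int (card I') + int (card J') - 2"
    unfolding s(3) by (rule adim_product) (use s(1,2) I(3) J(3) ne fin in blast)+
  moreover have "adim (pt m) (I \<times> J) = int (card I) + int (card J) - 2"
    by (rule adim_product[OF I J])
  ultimately have *: "card I + card J = Suc (card I' + card J')"
    using f by (simp add: facet_pts_def)
  have le: "card I' \<le> card I" "card J' \<le> card J" using s I J by (auto intro: card_mono)
  have del: "\<exists>x\<in>A. A \<noteq> {x} \<and> B = A - {x}"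
    if "B \<subseteq> A" "finite A" "B \<noteq> {}" "card A = Suc (card B)" for A B :: "nat set"
  proof -
    have "card (A - B) = 1" using that by (simp add: card_Diff_subset finite_subset)
    then obtain x where "A - B = {x}" by (auto simp: card_1_singleton_iff)
    then have "x \<in> A" "B = A - {x}" using that(1) by auto
    then show ?thesis using that(3) by auto
  qed
  show "(\<exists>a\<in>I. I \<noteq> {a} \<and> S = (I - {a}) \<times> J) \<or> (\<exists>b\<in>J. J \<noteq> {b} \<and> S = I \<times> (J - {b}))"
  proof (cases "card J' = card J")
    case True
    then have "J' = J" using s J by (simp add: card_subset_eq)
    then show ?thesis using del[OF s(1) I(1) ne(1)] s(3) * by auto
  next
    case False
    then have "card I' = card I" "card J = Suc (card J')" using le * by auto
    then have "I' = I" using s I by (simp add: card_subset_eq)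
    then show ?thesis using del[OF s(2) J(1) ne(2)] s(3) \<open>card J = _\<close> by auto
  qed
next
  have rng: "1 \<le> fst v" "fst v \<le> m" "1 \<le> snd v" if "v \<in> I \<times> J" for v
    using that I(3) J(3) by auto
  \<comment> \<open>The negative of a single coordinate supports the facet on which that coordinate
    vanishes.\<close>
  have lf: "lin_fun (\<lambda>_. - 1) {k} x = - x k" for k x by (simp add: lin_fun_def)
  have dim: "adim (pt m) (I' \<times> J') = adim (pt m) (I \<times> J) - 1"
    if "I' \<subseteq> I" "J' \<subseteq> J" "I' \<noteq> {}" "J' \<noteq> {}" "card I + card J = Suc (card I' + card J')" for I' J'
  proof -
    have "finite I'" "finite J'" using finite_subset[OF that(1) I(1)] finite_subset[OF that(2) J(1)] .
    then have "adim (pt m) (I' \<times> J') = int (card I') + int (card J') - 2"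
      using that I J by (intro adim_product) auto
    then show ?thesis using that(5) adim_product[OF I J] by simp
  qed
  assume "(\<exists>a\<in>I. I \<noteq> {a} \<and> S = (I - {a}) \<times> J) \<or> (\<exists>b\<in>J. J \<noteq> {b} \<and> S = I \<times> (J - {b}))"
  then show "facet_pts (pt m) (I \<times> J) S"
  proof (elim disjE bexE conjE)
    fix a assume a: "a \<in> I" "I \<noteq> {a}" "S = (I - {a}) \<times> J"
    have "face_pts (pt m) (I \<times> J) S"
      unfolding face_pts_def a(3)
    proof (intro exI conjI)
      have v: "pt m v (a - 1) = of_bool (fst v = a)" if "v \<in> I \<times> J" for v
        using rng[OF that] rng[of "(a, snd v)"] a(1) that by (cases v) (auto simp: pt_def)
      show "\<forall>v\<in>I \<times> J. lin_fun (\<lambda>_. - 1) {a - 1} (pt m v) \<le> 0" using v by (simp add: lf)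
      show "(I - {a}) \<times> J = {v \<in> I \<times> J. lin_fun (\<lambda>_. - 1) {a - 1} (pt m v) = 0}"
        using v by (auto simp: lf)
    qed simp
    moreover have "card I > 0" using I by (simp add: card_gt_0_iff)
    moreover have "I - {a} \<noteq> {}" using a(1,2) by blast
    ultimately show ?thesis using a(1,3) I J dim[of "I - {a}" J] by (simp add: facet_pts_def)
  next
    fix b assume b: "b \<in> J" "J \<noteq> {b}" "S = I \<times> (J - {b})"
    have "face_pts (pt m) (I \<times> J) S"
      unfolding face_pts_def b(3)
    proof (intro exI conjI)
      have v: "pt m v (m + (b - 1)) = of_bool (snd v = b)" if "v \<in> I \<times> J" for v
        using rng[OF that] rng[of "(fst v, b)"] b(1) that by (cases v) (auto simp: pt_def)
      show "\<forall>v\<in>I \<times> J. lin_fun (\<lambda>_. - 1) {m + (b - 1)} (pt m v) \<le> 0" using v by (simp add: lf)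
      show "I \<times> (J - {b}) = {v \<in> I \<times> J. lin_fun (\<lambda>_. - 1) {m + (b - 1)} (pt m v) = 0}"
        using v by (auto simp: lf)
    qed simp
    moreover have "card J > 0" using J by (simp add: card_gt_0_iff)
    moreover have "J - {b} \<noteq> {}" using b(1,2) by blast
    ultimately show ?thesis using b(1,3) I J dim[of I "J - {b}"] by (simp add: facet_pts_def)
  qed
qed

section \<open>The triangulation and greedy weights\<close>

text \<open>A support \<open>F\<close> can be produced by the greedy rule iff each vertex \<open>(a, b)\<close>, used or not, exhausts
  its row or its column.\<close>

definition unblocked :: "('a \<times> 'b \<Rightarrow> nat) \<Rightarrow> 'a set \<Rightarrow> 'b set \<Rightarrow> ('a \<times> 'b) set \<Rightarrow> bool" where
  "unblocked r I J F \<longleftrightarrow> F \<subseteq> I \<times> J \<and>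
     (\<forall>a\<in>I. \<forall>b\<in>J. (\<forall>b'. (a, b') \<in> F \<longrightarrow> r (a, b') \<le> r (a, b)) \<or> (\<forall>a'. (a', b) \<in> F \<longrightarrow> r (a', b) \<le> r (a, b)))"

section \<open>Recursion by pulling the smallest vertex\<close>

text \<open>The recursion for maximal simplices passed on to all faces: a cone over \<open>v\<close>
  contains \<open>F\<close> iff its base contains \<open>F - {v}\<close>. Injectivity of
  \<open>r\<close> ensures that the apex picked by the inductive rule is \<open>v\<close>.\<close>

lemma revlex_tri_pull:
  assumes "finite A" "v \<in> A" "A \<noteq> {v}" "\<forall>u\<in>A. r v \<le> r u" "inj_on r A"
  shows "F \<in> revlex_tri p r A \<longleftrightarrow> (\<exists>S. facet_pts p A S \<and> v \<notin> S \<and> F - {v} \<in> revlex_tri p r S)"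
proof
  assume "F \<in> revlex_tri p r A"
  then obtain G where G: "revlex_max p r A G" "F \<subseteq> G"
    by (auto simp: revlex_tri_def complex_of_max_def)
  from G(1) show "\<exists>S. facet_pts p A S \<and> v \<notin> S \<and> F - {v} \<in> revlex_tri p r S"
  proof cases
    case (single u)
    then show ?thesis using assms by auto
  next
    case (cone u S G')
    have "r u = r v" using cone assms by (intro antisym) auto
    then have "u = v" using cone assms(2,5) by (auto dest: inj_onD)
    then show ?thesis using cone G(2) by (auto simp: revlex_tri_def complex_of_max_def)
  qed
next
  assume "\<exists>S. facet_pts p A S \<and> v \<notin> S \<and> F - {v} \<in> revlex_tri p r S"
  then obtain S G where "facet_pts p A S" "v \<notin> S" "revlex_max p r S G" "F - {v} \<subseteq> G"
    by (auto simp: revlex_tri_def complex_of_max_def)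
  then have "revlex_max p r A (insert v G)" "F \<subseteq> insert v G"
    using assms by (auto intro: revlex_max.cone)
  then show "F \<in> revlex_tri p r A" by (auto simp: revlex_tri_def complex_of_max_def)
qed

text \<open>Only \<open>(a, b)\<close> itself has rank at most the minimum, so the condition at
  \<open>(a, b)\<close> says that \<open>F\<close> has nothing else in row \<open>a\<close> or
  nothing else in column \<open>b\<close>. Conversely, a vertex of the deleted line meets the
  condition because \<open>F\<close> has at most \<open>(a, b)\<close> on that line; at all other
  vertices, adding \<open>(a, b)\<close> is harmless by minimality of its rank.\<close>

lemma unblocked_pull:
  assumes v: "a \<in> I" "b \<in> J" "\<forall>u\<in>I \<times> J. r (a, b) \<le> r u" "inj_on r (I \<times> J)"
  shows "unblocked r I J F \<longleftrightarrow>
    unblocked r (I - {a}) J (F - {(a, b)}) \<or> unblocked r I (J - {b}) (F - {(a, b)})"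
proof
  assume F: "unblocked r I J F"
  have only: "u = (a, b)" if "u \<in> F" "r u \<le> r (a, b)" for u
  proof -
    have u: "u \<in> I \<times> J" using F that by (auto simp: unblocked_def)
    then have "r (a, b) \<le> r u" using v(3) by blast
    with that(2) have "r u = r (a, b)" by simp
    then show ?thesis using v u by (auto dest: inj_onD)
  qed
  have "(\<forall>b'. (a, b') \<in> F \<longrightarrow> r (a, b') \<le> r (a, b)) \<or> (\<forall>a'. (a', b) \<in> F \<longrightarrow> r (a', b) \<le> r (a, b))"
    using F v by (auto simp: unblocked_def)
  then show "unblocked r (I - {a}) J (F - {(a, b)}) \<or> unblocked r I (J - {b}) (F - {(a, b)})"
  proof
    assume "\<forall>b'. (a, b') \<in> F \<longrightarrow> r (a, b') \<le> r (a, b)"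
    then have "F - {(a, b)} \<subseteq> (I - {a}) \<times> J" using only F by (auto simp: unblocked_def)
    then show ?thesis using F by (simp add: unblocked_def) blast
  next
    assume "\<forall>a'. (a', b) \<in> F \<longrightarrow> r (a', b) \<le> r (a, b)"
    then have "F - {(a, b)} \<subseteq> I \<times> (J - {b})" using only F by (auto simp: unblocked_def)
    then show ?thesis using F by (simp add: unblocked_def) blast
  qed
next
  have low: "r (a, b) \<le> r (a', b')" if "a' \<in> I" "b' \<in> J" for a' b' using v that by auto
  assume "unblocked r (I - {a}) J (F - {(a, b)}) \<or> unblocked r I (J - {b}) (F - {(a, b)})"
  then show "unblocked r I J F"
  proof
    assume F: "unblocked r (I - {a}) J (F - {(a, b)})"
    then have sub: "F - {(a, b)} \<subseteq> (I - {a}) \<times> J" by (simp add: unblocked_def)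
    show ?thesis
      unfolding unblocked_def
    proof (intro conjI ballI)
      show "F \<subseteq> I \<times> J" using sub v by auto
      fix a1 b1 assume 1: "a1 \<in> I" "b1 \<in> J"
      show "(\<forall>b'. (a1, b') \<in> F \<longrightarrow> r (a1, b') \<le> r (a1, b1)) \<or> (\<forall>a'. (a', b1) \<in> F \<longrightarrow> r (a', b1) \<le> r (a1, b1))"
      proof (cases "a1 = a")
        case True
        have "b' = b" if "(a, b') \<in> F" for b' using sub that by auto
        then show ?thesis using low 1 True by metis
      next
        case False
        then have "(\<forall>b'. (a1, b') \<in> F - {(a, b)} \<longrightarrow> r (a1, b') \<le> r (a1, b1)) \<or> (\<forall>a'. (a', b1) \<in> F - {(a, b)} \<longrightarrow> r (a', b1) \<le> r (a1, b1))"
          using F 1 unfolding unblocked_def by blast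
        then show ?thesis using low[OF 1] by (metis Diff_iff singletonD)
      qed
    qed
  next
    assume F: "unblocked r I (J - {b}) (F - {(a, b)})"
    then have sub: "F - {(a, b)} \<subseteq> I \<times> (J - {b})" by (simp add: unblocked_def)
    show ?thesis
      unfolding unblocked_def
    proof (intro conjI ballI)
      show "F \<subseteq> I \<times> J" using sub v by auto
      fix a1 b1 assume 1: "a1 \<in> I" "b1 \<in> J"
      show "(\<forall>b'. (a1, b') \<in> F \<longrightarrow> r (a1, b') \<le> r (a1, b1)) \<or> (\<forall>a'. (a', b1) \<in> F \<longrightarrow> r (a', b1) \<le> r (a1, b1))"
      proof (cases "b1 = b")
        case True
        have "a' = a" if "(a', b) \<in> F" for a' using sub that by auto
        then show ?thesis using low 1 True by metis
      next
        case False
        then have "(\<forall>b'. (a1, b') \<in> F - {(a, b)} \<longrightarrow> r (a1, b') \<le> r (a1, b1)) \<or> (\<forall>a'. (a', b1) \<in> F - {(a, b)} \<longrightarrow> r (a', b1) \<le> r (a1, b1))"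
          using F 1 unfolding unblocked_def by blast
        then show ?thesis using low[OF 1] by (metis Diff_iff singletonD)
      qed
    qed
  qed
qed

lemma product_rank_min:
  assumes "finite I" "I \<noteq> {}" "finite J" "J \<noteq> {}"
  obtains a b where "a \<in> I" "b \<in> J" "\<forall>u\<in>I \<times> J. (r :: _ \<Rightarrow> nat) (a, b) \<le> r u"
proof -
  have "\<exists>v\<in>I \<times> J. \<forall>u\<in>I \<times> J. r v \<le> r u"
    using assms by (intro bexI[of _ "arg_min_on r (I \<times> J)"] ballI arg_min_least arg_min_if_finite(1)) auto
  then show ?thesis using that by (metis SigmaE)
qed

text \<open>Both sides satisfy the same recursion: at the smallest vertex, delete its row or its
  column. The induction is on \<open>card I + card J\<close>.\<close>

lemma revlex_tri_product:
  assumes "finite I" "I \<noteq> {}" "I \<subseteq> {1..m}" "finite J" "J \<noteq> {}" "J \<subseteq> {1..}" "inj_on r (I \<times> J)"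
  shows "F \<in> revlex_tri (pt m) r (I \<times> J) \<longleftrightarrow> unblocked r I J F"
  using assms
proof (induction "card I + card J" arbitrary: I J F rule: less_induct)
  case less
  obtain a b where ab: "a \<in> I" "b \<in> J" "\<forall>u\<in>I \<times> J. r (a, b) \<le> r u"
    using product_rank_min less.prems by metis
  have inj': "inj_on r ((I - {a}) \<times> J)" "inj_on r (I \<times> (J - {b}))"
    by (rule inj_on_subset[OF less.prems(7)]; auto)+
  show ?case
  proof (cases "I = {a} \<and> J = {b}")
    case True
    \<comment> \<open>In the one-point case a deletion would empty a factor, so only the rule
      \<open>single\<close> can apply.\<close>
    have nofacet: "\<not> facet_pts (pt m) (I \<times> J) S" for S
      unfolding facet_pts_product[OF less.prems(1-6)] using True by blast
    have "G = {(a, b)}" if "revlex_max (pt m) r (I \<times> J) G" for G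
      using that
    proof cases
      case (single v)
      then show ?thesis using True by auto
    next
      case (cone v S G')
      then show ?thesis using nofacet by blast
    qed
    moreover have "revlex_max (pt m) r (I \<times> J) {(a, b)}" using True by (auto intro: revlex_max.single)
    ultimately have "{G. revlex_max (pt m) r (I \<times> J) G} = {{(a, b)}}" by blast
    then have "F \<in> revlex_tri (pt m) r (I \<times> J) \<longleftrightarrow> F \<subseteq> {(a, b)}"
      by (simp add: revlex_tri_def complex_of_max_def)
    then show ?thesis using True by (auto simp: unblocked_def)
  next
    case False
    have cardI: "card (I - {a}) + card J < card I + card J"
      using card_Diff1_less[of I a] less.prems ab by linarith
    have cardJ: "card I + card (J - {b}) < card I + card J"
      using card_Diff1_less[of J b] less.prems ab by linarith
    have row: "F - {(a, b)} \<in> revlex_tri (pt m) r ((I - {a}) \<times> J) \<longleftrightarrow> unblocked r (I - {a}) J (F - {(a, b)})"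
      if "I \<noteq> {a}"
      by (rule less.hyps[OF cardI]) (use that less.prems(1-6) ab(1) inj' in blast)+
    have col: "F - {(a, b)} \<in> revlex_tri (pt m) r (I \<times> (J - {b})) \<longleftrightarrow> unblocked r I (J - {b}) (F - {(a, b)})"
      if "J \<noteq> {b}"
      by (rule less.hyps[OF cardJ]) (use that less.prems(1-6) ab(2) inj' in blast)+
    have "F \<in> revlex_tri (pt m) r (I \<times> J) \<longleftrightarrow>
      (\<exists>S. facet_pts (pt m) (I \<times> J) S \<and> (a, b) \<notin> S \<and> F - {(a, b)} \<in> revlex_tri (pt m) r S)"
    proof (rule revlex_tri_pull)
      show "I \<times> J \<noteq> {(a, b)}" using False ab(1,2) by blast
    qed (use less.prems(1,4,7) ab in auto)
    also have "\<dots> \<longleftrightarrow> (I \<noteq> {a} \<and> F - {(a, b)} \<in> revlex_tri (pt m) r ((I - {a}) \<times> J))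
      \<or> (J \<noteq> {b} \<and> F - {(a, b)} \<in> revlex_tri (pt m) r (I \<times> (J - {b})))"
    proof -
      have "(a, b) \<in> (I - {a'}) \<times> J \<longleftrightarrow> a' \<noteq> a" "(a, b) \<in> I \<times> (J - {b'}) \<longleftrightarrow> b' \<noteq> b" for a' b'
        using ab(1,2) by auto
      then show ?thesis unfolding facet_pts_product[OF less.prems(1-6)] using ab(1,2) by metis
    qed
    also have "\<dots> \<longleftrightarrow> (I \<noteq> {a} \<and> unblocked r (I - {a}) J (F - {(a, b)}))
      \<or> (J \<noteq> {b} \<and> unblocked r I (J - {b}) (F - {(a, b)}))"
      using row col by blast
    also have "\<dots> \<longleftrightarrow> unblocked r (I - {a}) J (F - {(a, b)}) \<or> unblocked r I (J - {b}) (F - {(a, b)})"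
    proof -
      have "unblocked r I (J - {b}) (F - {(a, b)})" if "unblocked r (I - {a}) J (F - {(a, b)})" "I = {a}"
        using that by (auto simp: unblocked_def)
      moreover have "unblocked r (I - {a}) J (F - {(a, b)})" if "unblocked r I (J - {b}) (F - {(a, b)})" "J = {b}"
        using that by (auto simp: unblocked_def)
      ultimately show ?thesis using False by blast
    qed
    also have "\<dots> \<longleftrightarrow> unblocked r I J F"
      using unblocked_pull[OF ab less.prems(7)] by simp
    finally show ?thesis .
  qed
qed

section \<open>Greedy weights with prescribed marginals\<close>

text \<open>Look at the smallest vertex where the weights differ. The weighting that is smaller
  there has no later support in the row or in the column of that vertex, so its sum along that line
  is strictly smaller, against equality of the marginals.\<close>

lemma unblocked_weights_unique:
  fixes s t :: "'a \<times> 'b \<Rightarrow> real"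
  assumes fin: "finite I" "finite J" and inj: "inj_on r (I \<times> J)"
    and s: "unblocked r I J {v\<in>I \<times> J. s v \<noteq> 0}" "\<forall>v\<in>I \<times> J. 0 \<le> s v"
    and t: "unblocked r I J {v\<in>I \<times> J. t v \<noteq> 0}" "\<forall>v\<in>I \<times> J. 0 \<le> t v"
    and row: "\<forall>a\<in>I. (\<Sum>b\<in>J. s (a, b)) = (\<Sum>b\<in>J. t (a, b))"
    and col: "\<forall>b\<in>J. (\<Sum>a\<in>I. s (a, b)) = (\<Sum>a\<in>I. t (a, b))"
  shows "\<forall>v\<in>I \<times> J. s v = t v"
proof (rule ccontr)
  assume ne: "\<not> (\<forall>v\<in>I \<times> J. s v = t v)"
  define D where "D = {v\<in>I \<times> J. s v \<noteq> t v}"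
  have D: "finite D" "D \<noteq> {}" using ne fin by (auto simp: D_def)
  define v where "v = arg_min_on r D"
  have v: "v \<in> D" "\<And>u. u \<in> D \<Longrightarrow> r v \<le> r u"
    using D by (auto simp: v_def arg_min_if_finite arg_min_least)
  obtain a b where ab: "v = (a, b)" "a \<in> I" "b \<in> J" using v by (auto simp: D_def)
  have agree: "s u = t u" if "u \<in> I \<times> J" "r u < r v" for u
    using v(2)[of u] that by (auto simp: D_def)
  \<comment> \<open>Stated for arbitrary \<open>f\<close> and \<open>g\<close> because either of
    \<open>s\<close> and \<open>t\<close> may be the smaller one at \<open>v\<close>.\<close>
  have False if st: "f v < g v" and f: "unblocked r I J {v\<in>I \<times> J. f v \<noteq> 0}"
    and g: "\<forall>v\<in>I \<times> J. 0 \<le> g v"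
    and row: "(\<Sum>b\<in>J. f (a, b)) = (\<Sum>b\<in>J. g (a, b))"
    and col: "(\<Sum>a\<in>I. f (a, b)) = (\<Sum>a\<in>I. g (a, b))"
    and agree: "\<And>u. u \<in> I \<times> J \<Longrightarrow> r u < r v \<Longrightarrow> f u = g u" for f g :: "'a \<times> 'b \<Rightarrow> real"
  proof -
    \<comment> \<open>Three sources: agreement before \<open>v\<close>, the strict inequality at
      \<open>v\<close>, and nonnegativity of \<open>g\<close> where \<open>f\<close>
      vanishes.\<close>
    have le: "f u \<le> g u" if "u \<in> I \<times> J" "f u \<noteq> 0 \<Longrightarrow> r u \<le> r v" for u
    proof (cases "f u = 0")
      case False
      then have "r u \<le> r v" using that(2) by blast
      then consider "r u < r v" | "r u = r v" by linarith
      then show ?thesis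
      proof cases
        case 2
        then have "u = v" using inj that ab by (auto dest: inj_onD)
        then show ?thesis using st by simp
      qed (use agree that in auto)
    qed (use g that in auto)
    have "(\<forall>b'. (a, b') \<in> {v\<in>I \<times> J. f v \<noteq> 0} \<longrightarrow> r (a, b') \<le> r (a, b)) \<or>
      (\<forall>a'. (a', b) \<in> {v\<in>I \<times> J. f v \<noteq> 0} \<longrightarrow> r (a', b) \<le> r (a, b))"
      using f ab unfolding unblocked_def by blast
    then show False
    proof
      assume *: "\<forall>b'. (a, b') \<in> {v\<in>I \<times> J. f v \<noteq> 0} \<longrightarrow> r (a, b') \<le> r (a, b)"
      have "(\<Sum>b\<in>J. f (a, b)) < (\<Sum>b\<in>J. g (a, b))"
        by (rule sum_strict_mono_ex1) (use fin le * ab st in auto)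
      then show False using row by simp
    next
      assume *: "\<forall>a'. (a', b) \<in> {v\<in>I \<times> J. f v \<noteq> 0} \<longrightarrow> r (a', b) \<le> r (a, b)"
      have "(\<Sum>a\<in>I. f (a, b)) < (\<Sum>a\<in>I. g (a, b))"
        by (rule sum_strict_mono_ex1) (use fin le * ab st in auto)
      then show False using col by simp
    qed
  qed
  note contra = this
  have "s v < t v \<or> t v < s v" using v(1) by (auto simp: D_def)
  then show False
  proof
    assume "s v < t v"
    then show False by (rule contra[OF _ s(1) t(2)]) (use row col agree ab in auto)
  next
    assume "t v < s v"
    then show False by (rule contra[OF _ t(1) s(2)]) (use row col agree ab in auto)
  qed
qed

text \<open>The greedy algorithm: the smallest vertex receives the smaller of its two marginals, the
  exhausted row or column is deleted, and the rest is filled recursively.\<close>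

lemma unblocked_weights_exist:
  fixes x :: "'a \<Rightarrow> real" and y :: "'b \<Rightarrow> real"
  assumes "finite I" "finite J" "inj_on r (I \<times> J)" "\<forall>a\<in>I. 0 \<le> x a" "\<forall>b\<in>J. 0 \<le> y b"
    "sum x I = sum y J"
  shows "\<exists>t. unblocked r I J {v. t v \<noteq> 0} \<and> (\<forall>v. 0 \<le> t v) \<and>
    (\<forall>a\<in>I. (\<Sum>b\<in>J. t (a, b)) = x a) \<and> (\<forall>b\<in>J. (\<Sum>a\<in>I. t (a, b)) = y b)"
  using assms
proof (induction "card I + card J" arbitrary: I J x y rule: less_induct)
  case less
  show ?case
  proof (cases "I = {} \<or> J = {}")
    case True
    \<comment> \<open>An empty factor makes the common total 0, so the nonnegative marginals all
      vanish.\<close>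
    then have "(\<forall>a\<in>I. x a = 0) \<and> (\<forall>b\<in>J. y b = 0)"
      using less.prems by (auto simp: sum_nonneg_eq_0_iff)
    then show ?thesis by (intro exI[of _ "\<lambda>_. 0"]) (auto simp: unblocked_def)
  next
    case False
    then obtain a b where ab: "a \<in> I" "b \<in> J" "\<forall>u\<in>I \<times> J. r (a, b) \<le> r u"
      using product_rank_min less.prems by metis
    have inj': "inj_on r ((I - {a}) \<times> J)" "inj_on r (I \<times> (J - {b}))"
      by (rule inj_on_subset[OF less.prems(3)]; auto)+
    show ?thesis
    proof (cases "x a \<le> y b")
      case True
      have cardI: "card (I - {a}) + card J < card I + card J"
        using card_Diff1_less[of I a] less.prems ab by linarith
      \<comment> \<open>What remains of column \<open>b\<close> once row \<open>a\<close> has been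
        served.\<close>
      define y' where "y' = y(b := y b - x a)"
      have sy: "sum y' J = sum y J - x a"
        using less.prems ab by (simp add: y'_def sum.remove[of J b])
      have "sum x (I - {a}) = sum y' J"
        using less.prems ab by (simp add: sy sum.remove[of I a])
      moreover have "\<forall>b\<in>J. 0 \<le> y' b" using less.prems(5) True by (simp add: y'_def)
      ultimately obtain t where t: "unblocked r (I - {a}) J {v. t v \<noteq> 0}" "\<forall>v. 0 \<le> t v"
        "\<forall>a\<in>I-{a}. (\<Sum>b\<in>J. t (a, b)) = x a" "\<forall>b\<in>J. (\<Sum>a\<in>I-{a}. t (a, b)) = y' b"
        using less.hyps[OF cardI, of x y'] less.prems(1,2,4) inj' by auto
      have t0: "t (a, b') = 0" for b' using t(1) by (auto simp: unblocked_def)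
      define t' where "t' = t((a, b) := x a)"
      \<comment> \<open>This holds even if \<open>x a = 0\<close>, and \<open>unblocked_pull\<close>
        does not ask whether \<open>(a, b)\<close> belongs to the support.\<close>
      have "{v. t v \<noteq> 0} = {v. t' v \<noteq> 0} - {(a, b)}" using t0 by (auto simp: t'_def)
      then have "unblocked r I J {v. t' v \<noteq> 0}"
        using t(1) unblocked_pull[OF ab less.prems(3)] by metis
      moreover have "\<forall>v. 0 \<le> t' v" using t(2) less.prems ab by (simp add: t'_def)
      moreover have "(\<Sum>b\<in>J. t' (a1, b)) = x a1" if "a1 \<in> I" for a1
      proof (cases "a1 = a")
        case True
        then show ?thesis using ab less.prems(2) t0
          by (simp add: t'_def sum.remove[of J b])
      next
        case False
        then show ?thesis using t(3) that by (simp add: t'_def)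
      qed
      moreover have "(\<Sum>a\<in>I. t' (a, b1)) = y b1" if "b1 \<in> J" for b1
      proof -
        have "(\<Sum>a\<in>I. t' (a, b1)) = t' (a, b1) + (\<Sum>a\<in>I-{a}. t' (a, b1))"
          using ab less.prems(1) by (simp add: sum.remove)
        also have "(\<Sum>a\<in>I-{a}. t' (a, b1)) = (\<Sum>a\<in>I-{a}. t (a, b1))"
          by (rule sum.cong) (auto simp: t'_def)
        finally show ?thesis using t(4) that t0 by (auto simp: t'_def y'_def)
      qed
      ultimately show ?thesis by blast
    next
      case False
      have cardJ: "card I + card (J - {b}) < card I + card J"
        using card_Diff1_less[of J b] less.prems ab by linarith
      define x' where "x' = x(a := x a - y b)"
      have sx: "sum x' I = sum x I - y b"
        using less.prems ab by (simp add: x'_def sum.remove[of I a])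
      have "sum x' I = sum y (J - {b})"
        using less.prems ab by (simp add: sx sum.remove[of J b])
      moreover have "\<forall>a\<in>I. 0 \<le> x' a" using less.prems(4) False by (simp add: x'_def)
      ultimately obtain t where t: "unblocked r I (J - {b}) {v. t v \<noteq> 0}" "\<forall>v. 0 \<le> t v"
        "\<forall>a\<in>I. (\<Sum>b\<in>J-{b}. t (a, b)) = x' a" "\<forall>b\<in>J-{b}. (\<Sum>a\<in>I. t (a, b)) = y b"
        using less.hyps[OF cardJ, of x' y] less.prems(1,2,5) inj' by auto
      have t0: "t (a', b) = 0" for a' using t(1) by (auto simp: unblocked_def)
      define t' where "t' = t((a, b) := y b)"
      have "{v. t v \<noteq> 0} = {v. t' v \<noteq> 0} - {(a, b)}" using t0 by (auto simp: t'_def)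
      then have "unblocked r I J {v. t' v \<noteq> 0}"
        using t(1) unblocked_pull[OF ab less.prems(3)] by metis
      moreover have "\<forall>v. 0 \<le> t' v" using t(2) less.prems ab by (simp add: t'_def)
      moreover have "(\<Sum>a\<in>I. t' (a, b1)) = y b1" if "b1 \<in> J" for b1
      proof (cases "b1 = b")
        case True
        then show ?thesis using ab less.prems(1) t0
          by (simp add: t'_def sum.remove[of I a])
      next
        case False
        then show ?thesis using t(4) that by (simp add: t'_def)
      qed
      moreover have "(\<Sum>b\<in>J. t' (a1, b)) = x a1" if "a1 \<in> I" for a1
      proof -
        have "(\<Sum>b\<in>J. t' (a1, b)) = t' (a1, b) + (\<Sum>b\<in>J-{b}. t' (a1, b))"
          using ab less.prems(2) by (simp add: sum.remove)
        also have "(\<Sum>b\<in>J-{b}. t' (a1, b)) = (\<Sum>b\<in>J-{b}. t (a1, b))"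
          by (rule sum.cong) (auto simp: t'_def)
        finally show ?thesis using t(3) that t0 by (auto simp: t'_def x'_def)
      qed
      ultimately show ?thesis by blast
    qed
  qed
qed

section \<open>Spherical sections of polyhedral cones\<close>

text \<open>A continuous bijection from a compact space onto a Hausdorff space is a homeomorphism,
  so no inverse has to be shown continuous.\<close>

lemma homeomorphic_space_compact_powertop:
  fixes S T :: "(nat \<Rightarrow> real) set"
  assumes "compact S" "continuous_on S f" "f ` S = T" "inj_on f S"
  shows "subtopology (powertop_real UNIV) S homeomorphic_space subtopology (powertop_real UNIV) T"
  unfolding euclidean_product_topology
proof (rule homeomorphic_map_imp_homeomorphic_space)
  show "homeomorphic_map (top_of_set S) (top_of_set T) f"
    using assms by (intro continuous_imp_homeomorphic_map) (auto simp: compact_space_subtopology Hausdorff_space_subtopology)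
qed

text \<open>By Tychonoff the cube of all sequences bounded by \<open>B\<close> is compact, and
  \<open>S\<close> is a closed subset of it.\<close>

lemma compact_pointwise_bounded:
  fixes S :: "(nat \<Rightarrow> real) set"
  assumes "closed S" "\<And>x k. x \<in> S \<Longrightarrow> \<bar>x k\<bar> \<le> B"
  shows "compact S"
proof -
  have "compact (PiE UNIV (\<lambda>_::nat. {-B..B}))"
    unfolding compactin_euclidean_iff[symmetric] euclidean_product_topology[symmetric]
    by (simp add: compactin_PiE)
  then have "compact (S \<inter> PiE UNIV (\<lambda>_. {-B..B}))" using assms(1) by (rule closed_Int_compact[rotated])
  moreover have "S \<inter> PiE UNIV (\<lambda>_. {-B..B}) = S" using assms(2) by (auto simp: abs_le_iff minus_le_iff)
  ultimately show ?thesis by simp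
qed

definition hyperplane_cone :: "nat \<Rightarrow> (nat \<Rightarrow> real) \<Rightarrow> nat set \<Rightarrow> (nat \<Rightarrow> real) set" where
  "hyperplane_cone N \<eta> J = {u. (\<forall>k\<ge>N. u k = 0) \<and> (\<Sum>k<N. \<eta> k * u k) = 0 \<and> (\<forall>k\<in>J. 0 \<le> u k)}"

text \<open>The radius is 2 because two probability vectors have total mass 2 together.\<close>

definition cone_section :: "nat \<Rightarrow> (nat \<Rightarrow> real) \<Rightarrow> nat set \<Rightarrow> (nat \<Rightarrow> real) set" where
  "cone_section N \<eta> J = {u \<in> hyperplane_cone N \<eta> J. (\<Sum>k<N. \<bar>u k\<bar>) = 2}"

lemma compact_cone_section: "compact (cone_section N \<eta> J)"
proof (rule compact_pointwise_bounded)
  have "cone_section N \<eta> J = (\<Inter>k\<in>{N..}. {u. u k = 0}) \<inter> {u. (\<Sum>k<N. \<eta> k * u k) = 0} \<inter>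
      (\<Inter>k\<in>J. {u. 0 \<le> u k}) \<inter> {u. (\<Sum>k<N. \<bar>u k\<bar>) = 2}"
    by (auto simp: cone_section_def hyperplane_cone_def)
  moreover have "closed \<dots>"
    by (intro closed_Int closed_INT ballI closed_Collect_eq closed_Collect_le continuous_intros
        continuous_on_product_coordinates)
  ultimately show "closed (cone_section N \<eta> J)" by simp
  fix u k assume u: "u \<in> cone_section N \<eta> J"
  show "\<bar>u k\<bar> \<le> 2"
  proof (cases "k < N")
    case True
    then have "\<bar>u k\<bar> \<le> (\<Sum>k<N. \<bar>u k\<bar>)" by (intro member_le_sum) auto
    then show ?thesis using u by (simp add: cone_section_def)
  qed (use u in \<open>simp add: cone_section_def hyperplane_cone_def\<close>)
qed

lemma hyperplane_cone_scale:
  assumes "u \<in> hyperplane_cone N \<eta> J" "0 \<le> c"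
  shows "(\<lambda>k. c * u k) \<in> hyperplane_cone N \<eta> J"
proof -
  have "(\<Sum>k<N. \<eta> k * (c * u k)) = c * (\<Sum>k<N. \<eta> k * u k)"
    by (simp add: sum_distrib_left mult_ac)
  then show ?thesis using assms by (simp add: hyperplane_cone_def)
qed

text \<open>Every ray of the cone meets both its section by the \<open>\<ell>\<^sup>1\<close>-sphere and its section \<open>M = 1\<close>
  exactly once.\<close>

lemma cone_section_homeomorphic:
  fixes M :: "(nat \<Rightarrow> real) \<Rightarrow> real" and L :: "(nat \<Rightarrow> real) \<Rightarrow> nat \<Rightarrow> real"
  assumes cont: "continuous_on UNIV M" "continuous_on UNIV L"
    and hom: "\<And>u c. 0 < c \<Longrightarrow> M (\<lambda>k. c * u k) = c * M u" "\<And>u c. L (\<lambda>k. c * u k) = (\<lambda>k. c * L u k)"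
    and pos: "\<And>u. u \<in> hyperplane_cone N \<eta> J \<Longrightarrow> u \<noteq> (\<lambda>_. 0) \<Longrightarrow> 0 < M u"
    and inj: "inj_on L {u \<in> hyperplane_cone N \<eta> J. M u = 1}"
  shows "subtopology (powertop_real UNIV) (cone_section N \<eta> J) homeomorphic_space
    subtopology (powertop_real UNIV) (L ` {u \<in> hyperplane_cone N \<eta> J. M u = 1})"
proof (rule homeomorphic_space_compact_powertop[OF compact_cone_section])
  let ?K = "hyperplane_cone N \<eta> J" and ?S = "cone_section N \<eta> J"
  \<comment> \<open>Rescale to \<open>M = 1\<close>, then apply \<open>L\<close>.\<close>
  define f where "f = (\<lambda>u. L (\<lambda>k. inverse (M u) * u k))"
  have feq: "f u = (\<lambda>k. inverse (M u) * L u k)" for u by (simp add: f_def hom)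
  have nz: "0 < M u" if "u \<in> ?S" for u
  proof -
    have "u \<noteq> (\<lambda>_. 0)" using that by (auto simp: cone_section_def)
    then show ?thesis using that pos by (auto simp: cone_section_def)
  qed
  have normal: "(\<lambda>k. inverse (M u) * u k) \<in> {u \<in> ?K. M u = 1}" if "u \<in> ?S" for u
    using nz[OF that] that hom(1)[of "inverse (M u)" u] by (auto simp: cone_section_def intro: hyperplane_cone_scale)
  have "continuous_on ?S M" "continuous_on ?S L" using cont by (auto intro: continuous_on_subset)
  then show "continuous_on ?S f"
    unfolding feq
    by (intro continuous_on_coordinatewise_then_product continuous_intros)
       (use nz in \<open>auto dest: continuous_on_product_then_coordinatewise less_imp_neq[THEN not_sym]\<close>)
  show "inj_on f ?S"
  proof (rule inj_onI)
    fix u v assume uv: "u \<in> ?S" "v \<in> ?S" "f u = f v"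
    then have eq: "(\<lambda>k. inverse (M u) * u k) = (\<lambda>k. inverse (M v) * v k)"
      using inj normal by (auto simp: f_def dest: inj_onD)
    then have k: "inverse (M u) * u k = inverse (M v) * v k" for k by metis
    \<comment> \<open>Points with the same rescaling lie on one ray; their common
      \<open>\<ell>1\<close>-norm 2 forces the two scaling factors to agree.\<close>
    have "inverse (M u) * (\<Sum>k<N. \<bar>u k\<bar>) = (\<Sum>k<N. \<bar>inverse (M u) * u k\<bar>)"
      using nz[OF uv(1)] by (simp add: sum_distrib_left abs_mult)
    also have "\<dots> = inverse (M v) * (\<Sum>k<N. \<bar>v k\<bar>)"
      unfolding k using nz[OF uv(2)] by (simp add: sum_distrib_left abs_mult)
    finally have "inverse (M u) = inverse (M v)" using uv by (simp add: cone_section_def)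
    then show "u = v" using k nz[OF uv(1)] by auto
  qed
  show "f ` ?S = L ` {u \<in> ?K. M u = 1}"
  proof (intro equalityI subsetI)
    fix w assume "w \<in> f ` ?S"
    then show "w \<in> L ` {u \<in> ?K. M u = 1}" using normal by (auto simp: f_def)
  next
    fix w assume "w \<in> L ` {u \<in> ?K. M u = 1}"
    then obtain u where u: "u \<in> ?K" "M u = 1" "w = L u" by auto
    \<comment> \<open>Homogeneity with factor 2 gives \<open>M 0 = 2 * M 0\<close>.\<close>
    have "M (\<lambda>_. 0) = 0" using hom(1)[of 2 "\<lambda>_. 0"] by simp
    then have "u \<noteq> (\<lambda>_. 0)" using u by auto
    then obtain j where "u j \<noteq> 0" by auto
    moreover from this have "j < N" using u(1) by (auto simp: hyperplane_cone_def not_le[symmetric])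
    ultimately have s: "0 < (\<Sum>k<N. \<bar>u k\<bar>)" by (intro sum_pos2[of _ j]) auto
    define c where "c = 2 / (\<Sum>k<N. \<bar>u k\<bar>)"
    have c: "0 < c" using s by (simp add: c_def)
    have "(\<Sum>k<N. \<bar>c * u k\<bar>) = c * (\<Sum>k<N. \<bar>u k\<bar>)"
      using c by (simp add: sum_distrib_left abs_mult)
    moreover have "c * (\<Sum>k<N. \<bar>u k\<bar>) = 2" using s by (simp add: c_def)
    ultimately have "(\<lambda>k. c * u k) \<in> ?S" using u c by (simp add: cone_section_def hyperplane_cone_scale)
    moreover have "f (\<lambda>k. c * u k) = w" using u c by (auto simp: feq hom)
    ultimately show "w \<in> f ` ?S" by blast
  qed
qed

section \<open>Coordinates on a hyperplane and the spherical case\<close>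

lemma hyperplane_sum_split:
  fixes \<eta> :: "nat \<Rightarrow> real"
  assumes "0 < N"
  shows "(\<Sum>k<N. \<eta> k * u k) = \<eta> 0 * u 0 + (\<Sum>k\<in>{1..<N}. \<eta> k * u k)"
  using assms by (simp add: lessThan_atLeast0 sum.atLeast_Suc_lessThan)

text \<open>As \<open>\<eta> 0 \<noteq> 0\<close>, the hyperplane equation can be solved for
  coordinate 0, so coordinates 1 to \<open>N - 1\<close> determine the point.\<close>

lemma hyperplane_cone_eqI:
  assumes "0 < N" "\<eta> 0 \<noteq> 0" "u \<in> hyperplane_cone N \<eta> J" "v \<in> hyperplane_cone N \<eta> J'"
    "\<And>k. 1 \<le> k \<Longrightarrow> k < N \<Longrightarrow> u k = v k"
  shows "u = v"
proof
  fix k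
  have "(\<Sum>k\<in>{1..<N}. \<eta> k * u k) = (\<Sum>k\<in>{1..<N}. \<eta> k * v k)" using assms(5) by (intro sum.cong) auto
  moreover have "(\<Sum>k<N. \<eta> k * u k) = (\<Sum>k<N. \<eta> k * v k)" using assms(3,4) by (simp add: hyperplane_cone_def)
  ultimately have "u 0 = v 0" using assms(1,2) by (simp add: hyperplane_sum_split)
  then show "u k = v k"
    using assms(3-5) by (cases "k = 0"; cases "k < N") (auto simp: hyperplane_cone_def)
qed

lemma hyperplane_extension:
  assumes "0 < N" "\<eta> 0 \<noteq> 0" "\<And>k. N \<le> k \<Longrightarrow> w k = 0"
  obtains u where "u \<in> hyperplane_cone N \<eta> {}" "\<And>k. 1 \<le> k \<Longrightarrow> u k = w k"
proof
  let ?u = "w(0 := - (\<Sum>k\<in>{1..<N}. \<eta> k * w k) / \<eta> 0)"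
  have "(\<Sum>k\<in>{1..<N}. \<eta> k * ?u k) = (\<Sum>k\<in>{1..<N}. \<eta> k * w k)" by (intro sum.cong) auto
  then have "(\<Sum>k<N. \<eta> k * ?u k) = 0" using assms by (subst hyperplane_sum_split) auto
  then show "?u \<in> hyperplane_cone N \<eta> {}" using assms by (auto simp: hyperplane_cone_def)
qed simp

lemma sqrt_sum_squares_scale:
  assumes "0 \<le> c"
  shows "sqrt (\<Sum>k<d. (c * w k)\<^sup>2) = c * sqrt (\<Sum>k<d. (w k)\<^sup>2)"
  using assms by (simp add: power_mult_distrib sum_distrib_left[symmetric] real_sqrt_mult)

text \<open>Without sign constraints the cone is the whole hyperplane, a copy of R^(N-1);
  \<open>M\<close> is the Euclidean norm there, so \<open>M = 1\<close> is the unit sphere.\<close>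

lemma hyperplane_section_nsphere:
  assumes "2 \<le> N" "\<eta> 0 \<noteq> 0"
  shows "subtopology (powertop_real UNIV) (cone_section N \<eta> {}) homeomorphic_space nsphere (N - 2)"
proof -
  \<comment> \<open>Drop the dependent coordinate 0 and shift the others down by one.\<close>
  define L :: "(nat \<Rightarrow> real) \<Rightarrow> nat \<Rightarrow> real" where "L = (\<lambda>u k. if k < N - 1 then u (k + 1) else 0)"
  define M where "M = (\<lambda>u. sqrt (\<Sum>k<N - 1. (L u k)\<^sup>2))"
  let ?K = "hyperplane_cone N \<eta> {}"
  have contLk: "continuous_on UNIV (\<lambda>u. L u k)" for k
    by (cases "k < N - 1") (simp_all add: L_def)
  have contL: "continuous_on UNIV L" using contLk by (rule continuous_on_coordinatewise_then_product)
  have contM: "continuous_on UNIV M" unfolding M_def by (intro continuous_intros contLk)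
  have homL: "L (\<lambda>k. c * u k) = (\<lambda>k. c * L u k)" for u c by (auto simp: L_def)
  have homM: "M (\<lambda>k. c * u k) = c * M u" if "0 < c" for u c
    using that by (simp add: M_def homL sqrt_sum_squares_scale)
  have Linj: "u = v" if "u \<in> ?K" "v \<in> ?K" "L u = L v" for u v
  proof (rule hyperplane_cone_eqI[OF _ assms(2) that(1,2)])
    fix k assume "1 \<le> k" "k < N"
    then show "u k = v k" using fun_cong[OF that(3), of "k - 1"] by (simp add: L_def split: if_splits)
  qed (use assms in simp)
  have pos: "0 < M u" if "u \<in> ?K" "u \<noteq> (\<lambda>_. 0)" for u
  proof (rule ccontr)
    assume "\<not> 0 < M u"
    then have "(\<Sum>k<N - 1. (L u k)\<^sup>2) = 0" by (simp add: M_def order_antisym sum_nonneg not_less)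
    then have "\<forall>k<N-1. L u k = 0" by (simp add: sum_nonneg_eq_0_iff)
    then have "L u = L (\<lambda>_. 0)" by (auto simp: L_def)
    then show False using Linj[of u "\<lambda>_. 0"] that by (auto simp: hyperplane_cone_def)
  qed
  have "L ` {u \<in> ?K. M u = 1} = {x. (\<forall>k\<ge>N - 1. x k = 0) \<and> (\<Sum>k<N - 1. (x k)\<^sup>2) = 1}"
  proof (intro equalityI subsetI)
    fix w assume "w \<in> L ` {u \<in> ?K. M u = 1}"
    then show "w \<in> {x. (\<forall>k\<ge>N - 1. x k = 0) \<and> (\<Sum>k<N - 1. (x k)\<^sup>2) = 1}" by (auto simp: M_def) (simp add: L_def)
  next
    fix w :: "nat \<Rightarrow> real" assume w: "w \<in> {x. (\<forall>k\<ge>N - 1. x k = 0) \<and> (\<Sum>k<N - 1. (x k)\<^sup>2) = 1}"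
    obtain u where u: "u \<in> ?K" "\<And>k. 1 \<le> k \<Longrightarrow> u k = w (k - 1)"
      using hyperplane_extension[of N \<eta> "\<lambda>k. w (k - 1)"] w assms by auto
    have "L u = w" using u(2) w by (auto simp: L_def)
    moreover from this have "M u = 1" using w by (simp add: M_def)
    ultimately show "w \<in> L ` {u \<in> ?K. M u = 1}" using u(1) by blast
  qed
  moreover have "subtopology (powertop_real UNIV) (cone_section N \<eta> {}) homeomorphic_space
    subtopology (powertop_real UNIV) (L ` {u \<in> ?K. M u = 1})"
    by (rule cone_section_homeomorphic) (use contL contM homL homM pos Linj in \<open>auto intro: inj_onI\<close>)
  moreover have "nsphere (N - 2) = subtopology (powertop_real UNIV) {x. (\<forall>k\<ge>N - 1. x k = 0) \<and> (\<Sum>k<N - 1. (x k)\<^sup>2) = 1}"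
  proof -
    \<comment> \<open>\<open>nsphere d\<close> lives in \<open>d + 1\<close> coordinates; here these
      are \<open>N - 1\<close>.\<close>
    have N: "Suc (N - 2) = N - 1" "{..N - 2} = {..<N - 1}" using assms by auto
    show ?thesis unfolding nsphere_def Euclidean_space_def subtopology_subtopology N
      by (rule arg_cong[of _ _ "subtopology _"]) auto
  qed
  ultimately show ?thesis by simp
qed

section \<open>The ball case: a cone with a strictly positive vector\<close>

lemma continuous_on_Min_image:
  fixes f :: "'i \<Rightarrow> 'a::topological_space \<Rightarrow> real"
  assumes "finite J" "J \<noteq> {}" "\<And>j. j \<in> J \<Longrightarrow> continuous_on S (f j)"
  shows "continuous_on S (\<lambda>x. Min ((\<lambda>j. f j x) ` J))"
  using assms
proof (induction J rule: finite_ne_induct)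
  case (insert j J)
  then have "continuous_on S (\<lambda>x. min (f j x) (Min ((\<lambda>j. f j x) ` J)))"
    by (intro continuous_on_min) auto
  then show ?case using insert by simp
qed simp

text \<open>Subtracting from \<open>u\<close> the largest possible multiple \<open>\<mu> u\<close> of the interior vector \<open>e\<close>
  leads to the boundary of the cone; hence \<open>u\<close> is determined by \<open>\<mu> u\<close> together with its class \<open>L u\<close>
  modulo \<open>e\<close>, and \<open>\<mu> + norm \<circ> L\<close> serves as the radial coordinate.\<close>

lemma cone_section_ball:
  assumes N: "2 \<le> N" and \<eta>: "\<eta> 0 \<noteq> 0" and J: "J \<subseteq> {..<N}" "N - 1 \<in> J"
    and e: "\<And>k. k < N \<Longrightarrow> 0 < e k" "(\<Sum>k<N. \<eta> k * e k) = 0"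
  shows "subtopology (powertop_real UNIV) (cone_section N \<eta> J) homeomorphic_space ball_top (N - 2)"
proof -
  let ?K = "hyperplane_cone N \<eta> J"
  \<comment> \<open>Coordinates of the class modulo \<open>e\<close>: the multiple of
    \<open>e\<close> that clears the last coordinate is subtracted. Coordinate 0 depends on the
    others and the last one is now 0, which leaves \<open>N - 2\<close>.\<close>
  define L :: "(nat \<Rightarrow> real) \<Rightarrow> nat \<Rightarrow> real"
    where "L = (\<lambda>u k. if k < N - 2 then u (k + 1) - e (k + 1) / e (N - 1) * u (N - 1) else 0)"
  \<comment> \<open>The largest \<open>t\<close> for which \<open>u - t e\<close> is still
    nonnegative on \<open>J\<close>.\<close>
  define \<mu> where "\<mu> = (\<lambda>u. Min ((\<lambda>k. u k / e k) ` J))"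
  define \<nu> where "\<nu> = (\<lambda>w::nat \<Rightarrow> real. sqrt (\<Sum>k<N - 2. (w k)\<^sup>2))"
  define M where "M = (\<lambda>u. \<mu> u + \<nu> (L u))"
  have fJ: "finite J" "J \<noteq> {}" using J finite_subset by auto
  have eJ: "0 < e k" if "k \<in> J" for k using that J e by auto
  have eN: "0 < e (N - 1)" using e N by auto
  have contLk: "continuous_on UNIV (\<lambda>u. L u k)" for k
    by (cases "k < N - 2") (use eN in \<open>auto simp: L_def intro!: continuous_intros continuous_on_product_coordinates\<close>)
  have contL: "continuous_on UNIV L" using contLk by (rule continuous_on_coordinatewise_then_product)
  have contM: "continuous_on UNIV M"
    unfolding M_def \<nu>_def \<mu>_def using eJ
    by (intro continuous_intros contLk continuous_on_Min_image fJ continuous_on_product_coordinates)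
       (auto dest: less_imp_neq[THEN not_sym])
  have homL: "L (\<lambda>k. c * u k) = (\<lambda>k. c * L u k)" for u c by (auto simp: L_def algebra_simps)
  have hom\<mu>: "\<mu> (\<lambda>k. c * u k) = c * \<mu> u" if "0 < c" for u c
  proof -
    have "mono ((*) c)" using that by (intro monoI) auto
    then have "c * Min ((\<lambda>k. u k / e k) ` J) = Min ((*) c ` (\<lambda>k. u k / e k) ` J)"
      by (rule mono_Min_commute) (use fJ in auto)
    then show ?thesis by (simp add: \<mu>_def image_image)
  qed
  have \<mu>_shift: "\<mu> u = \<mu> v + t" if "\<And>k. k < N \<Longrightarrow> u k = v k + t * e k" for u v t
  proof -
    have "mono (\<lambda>s. s + t)" by (intro monoI) auto
    then have "\<mu> v + t = Min ((\<lambda>s. s + t) ` (\<lambda>k. v k / e k) ` J)"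
      unfolding \<mu>_def by (rule mono_Min_commute) (use fJ in auto)
    also have "(\<lambda>s. s + t) ` (\<lambda>k. v k / e k) ` J = (\<lambda>k. u k / e k) ` J"
      unfolding image_image
    proof (rule image_cong)
      fix k assume "k \<in> J"
      then show "v k / e k + t = u k / e k" using that[of k] J eJ[of k] by (auto simp: field_simps)
    qed simp
    finally show ?thesis by (simp add: \<mu>_def)
  qed
  have homM: "M (\<lambda>k. c * u k) = c * M u" if "0 < c" for u c
    using that by (simp add: M_def homL hom\<mu> \<nu>_def sqrt_sum_squares_scale distrib_left)
  have \<mu>_nonneg: "0 \<le> \<mu> u" if "u \<in> ?K" for u
    using that fJ eJ by (auto simp: \<mu>_def hyperplane_cone_def intro!: divide_nonneg_pos)
  have \<nu>_nonneg: "0 \<le> \<nu> w" for w by (simp add: \<nu>_def sum_nonneg)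
  have Linj: "u = v" if uv: "u \<in> ?K" "v \<in> ?K" "L u = L v" "\<mu> u = \<mu> v" for u v
  proof -
    \<comment> \<open>Equality of \<open>L\<close> means that \<open>u\<close> and \<open>v\<close>
      differ by a multiple of \<open>e\<close>; the last coordinate reads off the factor
      \<open>t\<close>, and equality of \<open>\<mu>\<close> makes it 0.\<close>
    define t where "t = (u (N - 1) - v (N - 1)) / e (N - 1)"
    define v' where "v' = (\<lambda>k. if k < N then v k + t * e k else 0)"
    have "(\<Sum>k<N. \<eta> k * v' k) = (\<Sum>k<N. \<eta> k * v k) + t * (\<Sum>k<N. \<eta> k * e k)"
      by (simp add: v'_def sum_distrib_left sum.distrib[symmetric] algebra_simps)
    then have v': "v' \<in> hyperplane_cone N \<eta> {}" using uv(2) e(2) by (simp add: hyperplane_cone_def v'_def)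
    have "u = v'"
    proof (rule hyperplane_cone_eqI[OF _ \<eta> uv(1) v'])
      fix k assume k: "1 \<le> k" "k < N"
      show "u k = v' k"
      proof (cases "k = N - 1")
        case True then show ?thesis using eN N by (simp add: v'_def t_def)
      next
        case False
        then have "k - 1 < N - 2" using k by auto
        then have "u k - e k / e (N - 1) * u (N - 1) = v k - e k / e (N - 1) * v (N - 1)"
          using fun_cong[OF uv(3), of "k - 1"] k by (simp add: L_def)
        then show ?thesis using k eN by (simp add: v'_def t_def field_simps)
      qed
    qed (use N in simp)
    then have u: "u k = v k + t * e k" if "k < N" for k using that by (simp add: v'_def)
    then have "t = 0" using \<mu>_shift[of u v t] uv(4) by simp
    show ?thesis
    proof
      fix k
      show "u k = v k"
        using u[of k] \<open>t = 0\<close> uv(1,2) by (cases "k < N") (simp_all add: hyperplane_cone_def)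
    qed
  qed
  have zero: "(\<lambda>_. 0) \<in> ?K" "L (\<lambda>_. 0) = (\<lambda>_. 0)" "\<mu> (\<lambda>_. 0) = 0"
    using fJ by (auto simp: hyperplane_cone_def L_def \<mu>_def)
  have pos: "0 < M u" if "u \<in> ?K" "u \<noteq> (\<lambda>_. 0)" for u
  proof (rule ccontr)
    assume "\<not> 0 < M u"
    then have 0: "\<mu> u = 0" "\<nu> (L u) = 0" using \<mu>_nonneg[OF that(1)] \<nu>_nonneg[of "L u"] by (auto simp: M_def)
    then have "\<forall>k<N-2. L u k = 0" by (simp add: \<nu>_def sum_nonneg_eq_0_iff)
    then have "L u = (\<lambda>_. 0)" by (auto simp: L_def)
    then show False using Linj[OF that(1) zero(1)] zero 0 that(2) by simp
  qed
  \<comment> \<open>On \<open>M = 1\<close> the value of \<open>\<mu>\<close> is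
    \<open>1 - \<nu> (L u)\<close>, hence determined by \<open>L u\<close>.\<close>
  have "inj_on L {u \<in> ?K. M u = 1}"
    by (rule inj_onI) (auto simp: M_def intro: Linj)
  then have "subtopology (powertop_real UNIV) (cone_section N \<eta> J) homeomorphic_space
    subtopology (powertop_real UNIV) (L ` {u \<in> ?K. M u = 1})"
    by (intro cone_section_homeomorphic contL contM homL homM pos)
  moreover have "L ` {u \<in> ?K. M u = 1} = {x. (\<forall>k\<ge>N - 2. x k = 0) \<and> (\<Sum>k<N - 2. (x k)\<^sup>2) \<le> 1}"
  proof (intro equalityI subsetI)
    fix w assume "w \<in> L ` {u \<in> ?K. M u = 1}"
    then obtain u where u: "u \<in> ?K" "M u = 1" "w = L u" by auto
    then have "\<nu> w \<le> 1" using \<mu>_nonneg[OF u(1)] by (simp add: M_def)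
    then show "w \<in> {x. (\<forall>k\<ge>N - 2. x k = 0) \<and> (\<Sum>k<N - 2. (x k)\<^sup>2) \<le> 1}" using u(3) by (simp add: \<nu>_def L_def)
  next
    fix w :: "nat \<Rightarrow> real" assume w: "w \<in> {x. (\<forall>k\<ge>N - 2. x k = 0) \<and> (\<Sum>k<N - 2. (x k)\<^sup>2) \<le> 1}"
    then have "\<nu> w \<le> 1" by (simp add: \<nu>_def)
    obtain u where u: "u \<in> hyperplane_cone N \<eta> {}" "\<And>k. 1 \<le> k \<Longrightarrow> u k = w (k - 1)"
      using hyperplane_extension[of N \<eta> "\<lambda>k. w (k - 1)"] w N \<eta> by auto
    \<comment> \<open>Moving by \<open>t\<close> along \<open>e\<close> gives
      \<open>\<mu> v = 1 - \<nu> w\<close>. This is nonnegative, which puts \<open>v\<close> in the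
      cone, and it makes \<open>M v = 1\<close>.\<close>
    define t where "t = 1 - \<nu> w - \<mu> u"
    define v where "v = (\<lambda>k. if k < N then u k + t * e k else 0)"
    have \<mu>v: "\<mu> v = 1 - \<nu> w" using \<mu>_shift[of v u t] by (simp add: v_def t_def)
    have "0 \<le> v k" if "k \<in> J" for k
    proof -
      have "\<mu> v \<le> v k / e k" unfolding \<mu>_def using that fJ by (intro Min_le) auto
      then have "0 \<le> v k / e k" using \<mu>v \<open>\<nu> w \<le> 1\<close> by simp
      then show ?thesis using eJ[OF that] by (simp add: zero_le_divide_iff)
    qed
    moreover have "(\<Sum>k<N. \<eta> k * v k) = (\<Sum>k<N. \<eta> k * u k) + t * (\<Sum>k<N. \<eta> k * e k)"
      by (simp add: v_def sum_distrib_left sum.distrib[symmetric] algebra_simps)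
    ultimately have "v \<in> ?K" using u(1) e(2) by (simp add: hyperplane_cone_def v_def)
    moreover have "L v = w"
    proof
      fix k
      \<comment> \<open>The last coordinate of \<open>u\<close> is \<open>w (N - 2) = 0\<close>, so
        nothing is subtracted in \<open>L u\<close>, and \<open>e\<close> itself has class
        0.\<close>
      have "u (N - 1) = 0" using u(2)[of "N - 1"] w N by simp
      then show "L v k = w k" using w u(2)[of "k + 1"] eN N by (auto simp: L_def v_def)
    qed
    moreover from this have "M v = 1" using \<mu>v by (simp add: M_def)
    ultimately show "w \<in> L ` {u \<in> ?K. M u = 1}" by blast
  qed
  moreover have "ball_top (N - 2) = subtopology (powertop_real UNIV) {x. (\<forall>k\<ge>N - 2. x k = 0) \<and> (\<Sum>k<N - 2. (x k)\<^sup>2) \<le> 1}"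
    unfolding ball_top_def Euclidean_space_def subtopology_subtopology
    by (rule arg_cong[of _ _ "subtopology _"]) auto
  ultimately show ?thesis by simp
qed

section \<open>The realization as a cone section\<close>

lemma compact_geom_real:
  assumes "finite K" "\<And>F. F \<in> K \<Longrightarrow> finite F"
  shows "compact (geom_real idx K)"
proof (rule compact_pointwise_bounded)
  have "geom_real idx K = (\<Union>F\<in>K. (\<Inter>k. {x. 0 \<le> x k}) \<inter> (\<Inter>k\<in>- idx ` F. {x. x k = 0})
      \<inter> {x. (\<Sum>k\<in>idx ` F. x k) = 1})"
    by (auto simp: geom_real_def)
  moreover have "closed \<dots>"
    by (intro closed_UN assms(1) ballI closed_Int closed_INT closed_Collect_eq closed_Collect_le
        continuous_intros continuous_on_product_coordinates)
  ultimately show "closed (geom_real idx K)" by simp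
  fix x k assume "x \<in> geom_real idx K"
  then obtain F where F: "F \<in> K" "\<forall>k. 0 \<le> x k" "\<forall>k. k \<notin> idx ` F \<longrightarrow> x k = 0" "(\<Sum>k\<in>idx ` F. x k) = 1"
    by (auto simp: geom_real_def)
  show "\<bar>x k\<bar> \<le> 1"
  proof (cases "k \<in> idx ` F")
    case True
    then have "x k \<le> (\<Sum>k\<in>idx ` F. x k)" using F assms(2) by (intro member_le_sum) auto
    then show ?thesis using F by simp
  qed (use F in simp)
qed

text \<open>Row-major numbering, inverted by division with remainder by \<open>n\<close>.\<close>

lemma inj_on_vidx: "inj_on (vidx n) ({1..m} \<times> {1..n})"
proof (rule inj_onI)
  fix u v assume uv: "u \<in> {1..m} \<times> {1..n}" "v \<in> {1..m} \<times> {1..n}" "vidx n u = vidx n v"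
  have d: "vidx n w div n = fst w - 1" "vidx n w mod n = snd w - 1" if "w \<in> {1..m} \<times> {1..n}" for w
  proof -
    obtain a b where "w = (Suc a, Suc b)" "b < n"
    proof (rule that)
      show "w = (Suc (fst w - 1), Suc (snd w - 1))" "snd w - 1 < n" using \<open>w \<in> _\<close> by auto
    qed
    then show "vidx n w div n = fst w - 1" "vidx n w mod n = snd w - 1" by (simp_all add: vidx_def)
  qed
  have "fst u - 1 = fst v - 1" "snd u - 1 = snd v - 1" using d[OF uv(1)] d[OF uv(2)] uv(3) by auto
  then show "u = v" using uv by (auto simp: prod_eq_iff)
qed

text \<open>Replaces the unspecified face carrying \<open>t\<close> by the support of
  \<open>t\<close>, which is again a face since \<open>K\<close> is closed under subsets. Removing
  \<open>D\<close> becomes vanishing on \<open>D\<close>.\<close>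

lemma geom_real_remove_cone_points_iff:
  assumes idx: "inj_on idx A" and A: "finite A"
    and K: "\<And>F. F \<in> K \<Longrightarrow> F \<subseteq> A" "\<And>F G. G \<in> K \<Longrightarrow> F \<subseteq> G \<Longrightarrow> F \<in> K"
  shows "t \<in> geom_real idx (remove_cone_points K D) \<longleftrightarrow>
    (\<forall>k. 0 \<le> t k) \<and> (\<forall>k. k \<notin> idx ` A \<longrightarrow> t k = 0) \<and> {v\<in>A. t (idx v) \<noteq> 0} \<in> K \<and>
    (\<forall>v\<in>A \<inter> D. t (idx v) = 0) \<and> (\<Sum>v\<in>A. t (idx v)) = 1"
proof -
  have sum: "(\<Sum>k\<in>idx ` F. t k) = (\<Sum>v\<in>A. t (idx v))"
    if "F \<subseteq> A" "\<forall>k. k \<notin> idx ` F \<longrightarrow> t k = 0" for F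
  proof -
    have "(\<Sum>k\<in>idx ` F. t k) = (\<Sum>k\<in>idx ` A. t k)"
      using that A by (intro sum.mono_neutral_left) auto
    then show ?thesis using idx by (simp add: sum.reindex)
  qed
  show ?thesis
  proof
    assume "t \<in> geom_real idx (remove_cone_points K D)"
    then obtain F where F: "F \<in> K" "F \<inter> D = {}" "\<forall>k. 0 \<le> t k" "\<forall>k. k \<notin> idx ` F \<longrightarrow> t k = 0"
      "(\<Sum>k\<in>idx ` F. t k) = 1" by (auto simp: geom_real_def remove_cone_points_def)
    note FA = K(1)[OF F(1)]
    have sub: "{v\<in>A. t (idx v) \<noteq> 0} \<subseteq> F"
    proof
      fix v assume v: "v \<in> {v\<in>A. t (idx v) \<noteq> 0}"
      then have "idx v \<in> idx ` F" using F(4) by blast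
      then show "v \<in> F" using idx FA v by (auto dest: inj_onD)
    qed
    then show "(\<forall>k. 0 \<le> t k) \<and> (\<forall>k. k \<notin> idx ` A \<longrightarrow> t k = 0) \<and> {v\<in>A. t (idx v) \<noteq> 0} \<in> K \<and>
      (\<forall>v\<in>A \<inter> D. t (idx v) = 0) \<and> (\<Sum>v\<in>A. t (idx v)) = 1"
    proof (intro conjI)
      show "\<forall>k. k \<notin> idx ` A \<longrightarrow> t k = 0" using F(4) FA by blast
      show "\<forall>v\<in>A \<inter> D. t (idx v) = 0" using sub F(2) by blast
      show "(\<Sum>v\<in>A. t (idx v)) = 1" using sum[OF FA F(4)] F(5) by simp
    qed (use F(3) K(2)[OF F(1) sub] in auto)
  next
    assume t: "(\<forall>k. 0 \<le> t k) \<and> (\<forall>k. k \<notin> idx ` A \<longrightarrow> t k = 0) \<and> {v\<in>A. t (idx v) \<noteq> 0} \<in> K \<and>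
      (\<forall>v\<in>A \<inter> D. t (idx v) = 0) \<and> (\<Sum>v\<in>A. t (idx v)) = 1"
    define F where "F = {v\<in>A. t (idx v) \<noteq> 0}"
    have z: "\<forall>k. k \<notin> idx ` F \<longrightarrow> t k = 0" using t by (auto simp: F_def)
    have "F \<in> remove_cone_points K D" using t by (auto simp: remove_cone_points_def F_def)
    moreover have "(\<Sum>k\<in>idx ` F. t k) = 1" using sum[OF _ z] t by (simp add: F_def)
    ultimately show "t \<in> geom_real idx (remove_cone_points K D)"
      using t z unfolding geom_real_def by blast
  qed
qed

text \<open>The sign of coordinate \<open>j < i\<close> records which of \<open>x (j + 1)\<close> and \<open>y (j + 1)\<close> is nonzero;
  \<open>x\<close> and \<open>y\<close> are indexed from 1.\<close>

definition signed_coords :: "nat \<Rightarrow> nat \<Rightarrow> nat \<Rightarrow> (nat \<Rightarrow> real) \<Rightarrow> (nat \<Rightarrow> real) \<Rightarrow> nat \<Rightarrow> real" where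
  "signed_coords m n i x y j = (if j < i then x (j + 1) - y (j + 1) else if j < m then x (j + 1)
     else if j < m + n - i then y (j - m + i + 1) else 0)"

text \<open>The normal vector that turns the hyperplane equation for signed coordinates into
  equality of the totals of \<open>x\<close> and \<open>y\<close>.\<close>

definition row_col_sign :: "nat \<Rightarrow> nat \<Rightarrow> real" where
  "row_col_sign m j = (if j < m then 1 else - 1)"

section \<open>Sums and inversion of signed coordinates\<close>

lemma sum_three_blocks:
  fixes f g h :: "nat \<Rightarrow> real"
  assumes "i \<le> m" "i \<le> n"
  shows "(\<Sum>j<m + n - i. if j < i then f (j + 1) else if j < m then g (j + 1) else h (j - m + i + 1))
    = (\<Sum>k\<in>{1..i}. f k) + (\<Sum>k\<in>{i+1..m}. g k) + (\<Sum>k\<in>{i+1..n}. h k)" (is "(\<Sum>j<_. ?F j) = _")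
proof -
  have "{..<m + n - i} = {..<i} \<union> {i..<m} \<union> {m..<m + n - i}" using assms by auto
  moreover have "({..<i} \<union> {i..<m}) \<inter> {m..<m + n - i} = {}" using assms by auto
  ultimately have "(\<Sum>j<m + n - i. ?F j) = (\<Sum>j\<in>{..<i} \<union> {i..<m}. ?F j) + (\<Sum>j\<in>{m..<m + n - i}. ?F j)"
    by (simp only: sum.union_disjoint finite_Un finite_lessThan finite_atLeastLessThan simp_thms)
  also have "(\<Sum>j\<in>{..<i} \<union> {i..<m}. ?F j) = (\<Sum>j<i. ?F j) + (\<Sum>j\<in>{i..<m}. ?F j)"
    by (intro sum.union_disjoint) auto
  also have "(\<Sum>j<i. ?F j) = (\<Sum>k\<in>{1..i}. f k)"
    by (rule sum.reindex_bij_witness[of _ "\<lambda>k. k - 1" "\<lambda>j. j + 1"]) auto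
  also have "(\<Sum>j\<in>{i..<m}. ?F j) = (\<Sum>k\<in>{i+1..m}. g k)"
    by (rule sum.reindex_bij_witness[of _ "\<lambda>k. k - 1" "\<lambda>j. j + 1"]) auto
  \<comment> \<open>The first \<open>i\<close> columns already sit in the first block, so position
    \<open>m\<close> stands for column \<open>i + 1\<close>.\<close>
  also have "(\<Sum>j\<in>{m..<m + n - i}. ?F j) = (\<Sum>k\<in>{i+1..n}. h k)"
    by (rule sum.reindex_bij_witness[of _ "\<lambda>k. k + m - i - 1" "\<lambda>j. j - m + i + 1"]) (use assms in auto)
  finally show ?thesis .
qed

lemma sum_split_at:
  fixes f :: "nat \<Rightarrow> real"
  assumes "i \<le> m"
  shows "(\<Sum>k\<in>{1..m}. f k) = (\<Sum>k\<in>{1..i}. f k) + (\<Sum>k\<in>{i+1..m}. f k)"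
proof -
  have "{1..m} = {1..i} \<union> {i+1..m}" using assms by auto
  then show ?thesis by (simp add: sum.union_disjoint)
qed

lemma sum_signed_coords:
  assumes "i \<le> m" "i \<le> n"
  shows "(\<Sum>j<m + n - i. row_col_sign m j * signed_coords m n i x y j) = (\<Sum>a\<in>{1..m}. x a) - (\<Sum>b\<in>{1..n}. y b)"
proof -
  have "(\<Sum>j<m + n - i. row_col_sign m j * signed_coords m n i x y j) =
    (\<Sum>j<m + n - i. if j < i then (\<lambda>k. x k - y k) (j + 1) else if j < m then x (j + 1) else (\<lambda>k. - y k) (j - m + i + 1))"
    using assms by (intro sum.cong) (auto simp: signed_coords_def row_col_sign_def)
  also have "\<dots> = (\<Sum>k\<in>{1..i}. x k - y k) + (\<Sum>k\<in>{i+1..m}. x k) + (\<Sum>k\<in>{i+1..n}. - y k)"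
    by (rule sum_three_blocks[OF assms])
  finally show ?thesis
    unfolding sum_split_at[OF assms(1)] sum_split_at[OF assms(2)]
    by (simp add: sum_subtractf sum_negf)
qed

text \<open>Where one of \<open>x k\<close> and \<open>y k\<close> is 0 and both are nonnegative,
  the absolute value of their difference is their sum. With equal totals, norm 2 therefore means
  that both totals are 1.\<close>

lemma sum_abs_signed_coords:
  assumes "i \<le> m" "i \<le> n" "\<forall>a\<in>{1..m}. 0 \<le> x a" "\<forall>b\<in>{1..n}. 0 \<le> y b"
    "\<forall>k\<in>{1..i}. x k = 0 \<or> y k = 0"
  shows "(\<Sum>j<m + n - i. \<bar>signed_coords m n i x y j\<bar>) = (\<Sum>a\<in>{1..m}. x a) + (\<Sum>b\<in>{1..n}. y b)"
proof -
  have "(\<Sum>j<m + n - i. \<bar>signed_coords m n i x y j\<bar>) =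
    (\<Sum>j<m + n - i. if j < i then (\<lambda>k. x k + y k) (j + 1) else if j < m then x (j + 1) else y (j - m + i + 1))"
  proof (intro sum.cong refl)
    fix j assume j: "j \<in> {..<m + n - i}"
    consider "j < i" | "i \<le> j" "j < m" | "i \<le> j" "m \<le> j" by linarith
    then show "\<bar>signed_coords m n i x y j\<bar> =
      (if j < i then (\<lambda>k. x k + y k) (j + 1) else if j < m then x (j + 1) else y (j - m + i + 1))"
    proof cases
      case 1
      then have "0 \<le> x (j + 1)" "0 \<le> y (j + 1)" "x (j + 1) = 0 \<or> y (j + 1) = 0" using assms by auto
      then show ?thesis using 1 by (auto simp: signed_coords_def)
    next
      case 2
      then show ?thesis using assms(3) by (simp add: signed_coords_def)
    next
      case 3
      then have "j - m + i + 1 \<in> {1..n}" using j assms(1,2) by auto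
      then have "0 \<le> y (j - m + i + 1)" using assms(4) by blast
      then show ?thesis using 3 j by (simp add: signed_coords_def)
    qed
  qed
  also have "\<dots> = (\<Sum>k\<in>{1..i}. x k + y k) + (\<Sum>k\<in>{i+1..m}. x k) + (\<Sum>k\<in>{i+1..n}. y k)"
    by (rule sum_three_blocks[OF assms(1,2)])
  finally show ?thesis
    unfolding sum_split_at[OF assms(1)] sum_split_at[OF assms(2)]
    by (simp add: sum.distrib)
qed

text \<open>For \<open>k \<le> i\<close> the entries \<open>x k\<close> and \<open>y k\<close> are
  the positive and negative parts of their difference; all other entries appear as
  coordinates.\<close>

lemma signed_coords_eqD:
  assumes "i \<le> m" "i \<le> n" "signed_coords m n i x y = signed_coords m n i x' y'"
    and nn: "\<forall>k\<in>{1..i}. 0 \<le> x k \<and> 0 \<le> y k \<and> 0 \<le> x' k \<and> 0 \<le> y' k"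
    and z: "\<forall>k\<in>{1..i}. x k = 0 \<or> y k = 0" "\<forall>k\<in>{1..i}. x' k = 0 \<or> y' k = 0"
  shows "\<forall>a\<in>{1..m}. x a = x' a" "\<forall>b\<in>{1..n}. y b = y' b"
proof -
  have low: "x k = x' k \<and> y k = y' k" if "k \<in> {1..i}" for k
  proof -
    have "x k - y k = x' k - y' k" using fun_cong[OF assms(3), of "k - 1"] that by (simp add: signed_coords_def split: if_splits)
    then show ?thesis using bspec[OF nn that] bspec[OF z(1) that] bspec[OF z(2) that] by linarith
  qed
  show "\<forall>a\<in>{1..m}. x a = x' a"
  proof
    fix a assume a: "a \<in> {1..m}"
    show "x a = x' a"
    proof (cases "a \<le> i")
      case False
      then show ?thesis using fun_cong[OF assms(3), of "a - 1"] a by (simp add: signed_coords_def split: if_splits)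
    qed (use low a in auto)
  qed
  show "\<forall>b\<in>{1..n}. y b = y' b"
  proof
    fix b assume b: "b \<in> {1..n}"
    show "y b = y' b"
    proof (cases "b \<le> i")
      case False
      define j where "j = m + (b - i - 1)"
      have "\<not> j < i" "\<not> j < m" "j < m + n - i" "j - m + i + 1 = b"
        using False b assms(1) by (auto simp: j_def)
      then show ?thesis using fun_cong[OF assms(3), of j] by (simp only: signed_coords_def if_True if_False)
    qed (use low b in auto)
  qed
qed

lemma signed_coords_surj:
  assumes im: "i \<le> m" "i \<le> n" and u: "u \<in> cone_section (m + n - i) (row_col_sign m) {i..<m + n - i}"
  obtains x y where "\<forall>a\<in>{1..m}. 0 \<le> x a" "\<forall>b\<in>{1..n}. 0 \<le> y b" "\<forall>k\<in>{1..i}. x k = 0 \<or> y k = 0"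
    "(\<Sum>a\<in>{1..m}. x a) = 1" "(\<Sum>b\<in>{1..n}. y b) = 1" "u = signed_coords m n i x y"
proof -
  \<comment> \<open>Split the first \<open>i\<close> coordinates into positive and negative parts
    and read off the rest.\<close>
  define x where "x = (\<lambda>k. if k \<le> i then max (u (k - 1)) 0 else u (k - 1))"
  define y where "y = (\<lambda>k. if k \<le> i then max (- u (k - 1)) 0 else u (m + (k - i - 1)))"
  have nonneg: "0 \<le> u j" if "i \<le> j" "j < m + n - i" for j
    using u that by (simp add: cone_section_def hyperplane_cone_def)
  have x: "\<forall>a\<in>{1..m}. 0 \<le> x a" using nonneg im by (auto simp: x_def)
  have y: "\<forall>b\<in>{1..n}. 0 \<le> y b" using nonneg im by (auto simp: y_def)
  have xy: "\<forall>k\<in>{1..i}. x k = 0 \<or> y k = 0" by (auto simp: x_def y_def)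
  have eq: "u = signed_coords m n i x y"
  proof
    fix j
    have "m + (j - m + i + 1 - i - 1) = j" if "m \<le> j" using that by simp
    moreover have "u j = 0" if "m + n - i \<le> j" using u that by (simp add: cone_section_def hyperplane_cone_def)
    ultimately show "u j = signed_coords m n i x y j"
      using im by (auto simp: signed_coords_def x_def y_def max_def)
  qed
  have "(\<Sum>a\<in>{1..m}. x a) - (\<Sum>b\<in>{1..n}. y b) = 0"
    using u sum_signed_coords[OF im, of x y] by (simp add: eq[symmetric] cone_section_def hyperplane_cone_def)
  moreover have "(\<Sum>a\<in>{1..m}. x a) + (\<Sum>b\<in>{1..n}. y b) = 2"
    using u sum_abs_signed_coords[OF im x y xy] by (simp add: eq[symmetric] cone_section_def)
  ultimately have "(\<Sum>a\<in>{1..m}. x a) = 1" "(\<Sum>b\<in>{1..n}. y b) = 1" by simp_all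
  then show ?thesis using that x y xy eq by blast
qed

lemma Pmn_eq: "Pmn m n = {1..m} \<times> {1..n}"
  by (auto simp: Pmn_def)

section \<open>The homeomorphism given by marginals\<close>

text \<open>The map \<Phi> takes row and column sums and encodes them by signed coordinates. It is
  injective by uniqueness and surjective by existence of greedy weights, and its domain is
  compact.\<close>

lemma pulled_complex_homeomorphic_cone_section:
  fixes m n i :: nat and r :: "nat \<times> nat \<Rightarrow> nat"
  assumes m: "1 \<le> m" and i: "i \<le> m" "m \<le> n" and r: "inj_on r (Pmn m n)"
    and diag: "\<forall>v\<in>Pmn m n. v \<notin> (\<lambda>k. (k, k)) ` {1..i} \<longrightarrow> (\<forall>k\<in>{1..i}. r (k, k) < r v)"
  shows "real_top (vidx n) (remove_cone_points (revlex_tri (pt m) r (Pmn m n)) ((\<lambda>k. (k, k)) ` {1..i}))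
    homeomorphic_space
    subtopology (powertop_real UNIV) (cone_section (m + n - i) (row_col_sign m) {i..<m + n - i})"
proof -
  let ?A = "{1..m} \<times> {1..n}" and ?D = "(\<lambda>k. (k, k)) ` {1..i}" and ?N = "m + n - i"
  define K where "K = revlex_tri (pt m) r (Pmn m n)"
  let ?G = "geom_real (vidx n) (remove_cone_points K ?D)"
  have injr: "inj_on r ?A" using r by (simp add: Pmn_eq)
  have K: "F \<in> K \<longleftrightarrow> unblocked r {1..m} {1..n} F" for F
    unfolding K_def Pmn_eq by (rule revlex_tri_product) (use m i injr in auto)
  have Ksub: "F \<subseteq> ?A" if "F \<in> K" for F using that by (simp add: K unblocked_def)
  have Kdown: "F \<in> K" if "G \<in> K" "F \<subseteq> G" for F G
    using that unfolding K unblocked_def by (meson subset_eq)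
  have G: "t \<in> ?G \<longleftrightarrow> (\<forall>k. 0 \<le> t k) \<and> (\<forall>k. k \<notin> vidx n ` ?A \<longrightarrow> t k = 0) \<and>
      unblocked r {1..m} {1..n} {v\<in>?A. t (vidx n v) \<noteq> 0} \<and>
      (\<forall>v\<in>?A \<inter> ?D. t (vidx n v) = 0) \<and> (\<Sum>v\<in>?A. t (vidx n v)) = 1" for t
    unfolding K[symmetric]
    by (rule geom_real_remove_cone_points_iff[OF inj_on_vidx _ Ksub Kdown]) simp_all
  define X where "X = (\<lambda>t a. \<Sum>b\<in>{1..n}. t (vidx n (a, b)) :: real)"
  define Y where "Y = (\<lambda>t b. \<Sum>a\<in>{1..m}. t (vidx n (a, b)) :: real)"
  define \<Phi> where "\<Phi> = (\<lambda>t. signed_coords m n i (X t) (Y t))"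
  \<comment> \<open>The removed vertex \<open>(k, k)\<close> carries weight 0, yet it must exhaust
    its row or its column. All other vertices on these two lines have larger rank, so one of the
    lines is entirely empty.\<close>
  have XY: "X t k = 0 \<or> Y t k = 0" if t: "t \<in> ?G" and k: "k \<in> {1..i}" for t k
  proof -
    have nd: "t (vidx n (k, k)) = 0" using t k i unfolding G by auto
    have un: "unblocked r {1..m} {1..n} {v\<in>?A. t (vidx n v) \<noteq> 0}" using t unfolding G by blast
    have kk: "k \<in> {1..m}" "k \<in> {1..n}" using k i by auto
    have up: "t (vidx n v) = 0" if "v \<in> ?A" "fst v = k \<or> snd v = k" "t (vidx n v) \<noteq> 0 \<longrightarrow> r v \<le> r (k, k)" for v
    proof (cases "v = (k, k)")
      case False
      \<comment> \<open>A row or column \<open>k\<close> meets the diagonal only in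
        \<open>(k, k)\<close>.\<close>
      then have "v \<notin> ?D" using that(2) by auto
      then have "r (k, k) < r v" using diag that(1) k unfolding Pmn_eq by blast
      then show ?thesis using that(3) by auto
    qed (use nd in simp)
    from un kk have "(\<forall>b'. (k, b') \<in> {v\<in>?A. t (vidx n v) \<noteq> 0} \<longrightarrow> r (k, b') \<le> r (k, k)) \<or>
      (\<forall>a'. (a', k) \<in> {v\<in>?A. t (vidx n v) \<noteq> 0} \<longrightarrow> r (a', k) \<le> r (k, k))"
      unfolding unblocked_def by blast
    then show ?thesis
    proof
      assume *: "\<forall>b'. (k, b') \<in> {v\<in>?A. t (vidx n v) \<noteq> 0} \<longrightarrow> r (k, b') \<le> r (k, k)"
      have "t (vidx n (k, b)) = 0" if "b \<in> {1..n}" for b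
        by (rule up) (use * kk(1) that in simp_all)
      then have "X t k = 0" by (simp add: X_def)
      then show ?thesis ..
    next
      assume *: "\<forall>a'. (a', k) \<in> {v\<in>?A. t (vidx n v) \<noteq> 0} \<longrightarrow> r (a', k) \<le> r (k, k)"
      have "t (vidx n (a, k)) = 0" if "a \<in> {1..m}" for a
        by (rule up) (use * kk(2) that in simp_all)
      then have "Y t k = 0" by (simp add: Y_def)
      then show ?thesis ..
    qed
  qed
  have nonneg: "0 \<le> X t a" "0 \<le> Y t b" if "t \<in> ?G" for t a b
    using that unfolding G X_def Y_def by (auto intro: sum_nonneg)
  have total: "(\<Sum>a\<in>{1..m}. X t a) = (\<Sum>v\<in>?A. t (vidx n v))" "(\<Sum>b\<in>{1..n}. Y t b) = (\<Sum>v\<in>?A. t (vidx n v))" for t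
  proof -
    show "(\<Sum>a\<in>{1..m}. X t a) = (\<Sum>v\<in>?A. t (vidx n v))"
      unfolding X_def by (simp add: sum.cartesian_product split_def)
    moreover have "(\<Sum>a\<in>{1..m}. X t a) = (\<Sum>b\<in>{1..n}. Y t b)"
      unfolding X_def Y_def by (rule sum.swap)
    ultimately show "(\<Sum>b\<in>{1..n}. Y t b) = (\<Sum>v\<in>?A. t (vidx n v))" by simp
  qed
  have inn: "i \<le> n" using i by simp
  have "compact ?G"
  proof (rule compact_geom_real)
    have "remove_cone_points K ?D \<subseteq> Pow ?A" using Ksub by (auto simp: remove_cone_points_def)
    then show "finite (remove_cone_points K ?D)" by (rule finite_subset) simp
    fix F assume "F \<in> remove_cone_points K ?D"
    then have "F \<subseteq> ?A" using Ksub by (simp add: remove_cone_points_def)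
    then show "finite F" by (rule finite_subset) simp
  qed
  moreover have "continuous_on ?G \<Phi>"
  proof (rule continuous_on_coordinatewise_then_product)
    have "continuous_on ?G (\<lambda>t. X t a)" "continuous_on ?G (\<lambda>t. Y t a)" for a
      unfolding X_def Y_def
      by (intro continuous_intros continuous_on_subset[OF continuous_on_product_coordinates] subset_UNIV)+
    then show "continuous_on ?G (\<lambda>t. \<Phi> t j)" for j
      unfolding \<Phi>_def signed_coords_def
      by (cases "j < i"; cases "j < m"; cases "j < m + n - i") (simp_all add: continuous_on_diff)
  qed
  moreover have "inj_on \<Phi> ?G"
  proof (rule inj_onI)
    fix s t assume st: "s \<in> ?G" "t \<in> ?G" "\<Phi> s = \<Phi> t"
    have "\<forall>a\<in>{1..m}. X s a = X t a" "\<forall>b\<in>{1..n}. Y s b = Y t b"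
      using signed_coords_eqD[OF i(1) inn st(3)[unfolded \<Phi>_def]] nonneg[OF st(1)] nonneg[OF st(2)]
        XY[OF st(1)] XY[OF st(2)] by blast+
    then have *: "\<forall>v\<in>?A. s (vidx n v) = t (vidx n v)"
      using st(1,2) unfolding G X_def Y_def
      by (intro unblocked_weights_unique[OF _ _ injr]) auto
    show "s = t"
    proof
      fix k
      show "s k = t k" using * st(1,2) unfolding G by (cases "k \<in> vidx n ` ?A") auto
    qed
  qed
  moreover have "\<Phi> ` ?G = cone_section ?N (row_col_sign m) {i..<?N}"
  proof (intro equalityI subsetI)
    fix u assume "u \<in> \<Phi> ` ?G"
    then obtain t where t: "t \<in> ?G" "u = signed_coords m n i (X t) (Y t)" by (auto simp: \<Phi>_def)
    have one: "(\<Sum>v\<in>?A. t (vidx n v)) = 1" using t(1) unfolding G by blast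
    have "(\<Sum>j<?N. \<bar>u j\<bar>) = 2"
      unfolding t(2) using nonneg[OF t(1)] XY[OF t(1)] total[of t] one
      by (subst sum_abs_signed_coords[OF i(1) inn]) auto
    moreover have "(\<Sum>j<?N. row_col_sign m j * u j) = 0"
      unfolding t(2) sum_signed_coords[OF i(1) inn] using total[of t] by simp
    moreover have "\<forall>j\<in>{i..<?N}. 0 \<le> u j" "\<forall>j\<ge>?N. u j = 0"
      using nonneg[OF t(1)] i by (auto simp: t(2) signed_coords_def)
    ultimately show "u \<in> cone_section ?N (row_col_sign m) {i..<?N}"
      by (simp add: cone_section_def hyperplane_cone_def)
  next
    fix u assume "u \<in> cone_section ?N (row_col_sign m) {i..<?N}"
    then obtain x y where xy: "\<forall>a\<in>{1..m}. 0 \<le> x a" "\<forall>b\<in>{1..n}. 0 \<le> y b" "\<forall>k\<in>{1..i}. x k = 0 \<or> y k = 0"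
      "(\<Sum>a\<in>{1..m}. x a) = 1" "(\<Sum>b\<in>{1..n}. y b) = 1" "u = signed_coords m n i x y"
      by (rule signed_coords_surj[OF i(1) inn])
    obtain w where w: "unblocked r {1..m} {1..n} {v. w v \<noteq> 0}" "\<forall>v. 0 \<le> w v"
      "\<forall>a\<in>{1..m}. (\<Sum>b\<in>{1..n}. w (a, b)) = x a" "\<forall>b\<in>{1..n}. (\<Sum>a\<in>{1..m}. w (a, b)) = y b"
      using unblocked_weights_exist[OF _ _ injr xy(1,2)] xy(4,5) by auto
    \<comment> \<open>The greedy weights transported to sequence coordinates, with 0 at indices that
      belong to no vertex.\<close>
    define t where "t = (\<lambda>k. if k \<in> vidx n ` ?A then w (inv_into ?A (vidx n) k) else 0)"
    have tw: "t (vidx n v) = w v" if "v \<in> ?A" for v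
      using that inj_on_vidx[of n m] by (simp add: t_def inv_into_f_f del: mem_Sigma_iff)
    have Xx: "X t a = x a" if "a \<in> {1..m}" for a
      using w(3) that tw by (simp add: X_def)
    have Yy: "Y t b = y b" if "b \<in> {1..n}" for b
      using w(4) that tw by (simp add: Y_def)
    have "t \<in> ?G"
      unfolding G
    proof (intro conjI)
      show "\<forall>k. 0 \<le> t k" by (simp add: t_def w(2)[rule_format])
      show "\<forall>k. k \<notin> vidx n ` ?A \<longrightarrow> t k = 0" by (simp add: t_def)
      have "{v\<in>?A. t (vidx n v) \<noteq> 0} = {v. w v \<noteq> 0}"
      proof -
        have "{v. w v \<noteq> 0} \<subseteq> ?A" using w(1) by (simp add: unblocked_def)
        then have "v \<in> ?A" if "w v \<noteq> 0" for v using that by blast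
        then show ?thesis using tw by (intro set_eqI) (simp only: mem_Collect_eq, metis)
      qed
      then show "unblocked r {1..m} {1..n} {v\<in>?A. t (vidx n v) \<noteq> 0}" using w(1) by simp
      show "\<forall>v\<in>?A \<inter> ?D. t (vidx n v) = 0"
      proof
        fix v assume v: "v \<in> ?A \<inter> ?D"
        then obtain k where k: "v = (k, k)" "k \<in> {1..i}" by auto
        \<comment> \<open>The weight at \<open>(k, k)\<close> is at most each of \<open>x k\<close>
          and \<open>y k\<close>, one of which is 0.\<close>
        have "w (k, k) \<le> (\<Sum>b\<in>{1..n}. w (k, b))" using w(2) k v by (intro member_le_sum) auto
        then have 1: "w (k, k) \<le> x k" using w(3) k v by simp
        have "w (k, k) \<le> (\<Sum>a\<in>{1..m}. w (a, k))"
          using w(2) k v by (intro member_le_sum[of k _ "\<lambda>a. w (a, k)"]) auto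
        then have 2: "w (k, k) \<le> y k" using w(4) k v by simp
        have "w (k, k) = 0" using 1 2 xy(3) k(2) w(2) by (metis order_antisym)
        then show "t (vidx n v) = 0" using tw[of v] v k(1) by simp
      qed
      show "(\<Sum>v\<in>?A. t (vidx n v)) = 1" using total(1)[of t] Xx xy(4) by simp
    qed
    moreover have "\<Phi> t = u"
    proof
      fix j
      show "\<Phi> t j = u j"
        unfolding \<Phi>_def xy(6) signed_coords_def using i Xx Yy by auto
    qed
    ultimately show "u \<in> \<Phi> ` ?G" by blast
  qed
  ultimately show ?thesis
    unfolding real_top_def K_def[symmetric] by (intro homeomorphic_space_compact_powertop)
qed

section \<open>Distinguishing the ball from the sphere\<close>

theorem theorem4p13:
  fixes m n i :: nat and r :: "nat \<times> nat \<Rightarrow> nat"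
  assumes "1 \<le> m" and "i \<le> m" and "m \<le> n"
    and "inj_on r (Pmn m n)"
    and "\<forall>k l. 1 \<le> k \<longrightarrow> k < l \<longrightarrow> l \<le> i \<longrightarrow> r (k, k) < r (l, l)"
    and "\<forall>v\<in>Pmn m n. v \<notin> (\<lambda>k. (k, k)) ` {1..i} \<longrightarrow> (\<forall>k\<in>{1..i}. r (k, k) < r v)"
  shows "((m < n \<or> (m = n \<and> i < m)) \<longrightarrow>
           real_top (vidx n) (remove_cone_points (revlex_tri (pt m) r (Pmn m n)) ((\<lambda>k. (k, k)) ` {1..i}))
             homeomorphic_space ball_top (m + n - i - 2)) \<and>
         ((i = m \<and> m = n) \<longrightarrow>
           real_top (vidx n) (remove_cone_points (revlex_tri (pt m) r (Pmn m n)) ((\<lambda>k. (k, k)) ` {1..i}))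
             homeomorphic_space (if n = 1 then trivial_topology else nsphere (n - 2)))"
proof (intro conjI impI)
  let ?N = "m + n - i"
  let ?S = "subtopology (powertop_real UNIV) (cone_section ?N (row_col_sign m) {i..<?N})"
  note hom = pulled_complex_homeomorphic_cone_section[OF assms(1-4,6)]
  have \<eta>: "row_col_sign m 0 \<noteq> 0" by (simp add: row_col_sign_def)
  {
    assume "m < n \<or> (m = n \<and> i < m)"
    then have lt: "i < n" using assms(2) by auto
    \<comment> \<open>A strictly positive vector in the hyperplane: \<open>m\<close> entries
      \<open>n - i\<close> with sign plus balance \<open>n - i\<close> entries \<open>m\<close> with
      sign minus. Positivity needs \<open>i < n\<close>, which is exactly the ball case.\<close>
    define e where "e = (\<lambda>j. if j < m then real (n - i) else real m)"
    have "{..<?N} = {..<m} \<union> {m..<?N}" using assms lt by auto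
    moreover have "{..<m} \<inter> {m..<?N} = {}" by auto
    ultimately have "(\<Sum>j<?N. row_col_sign m j * e j) =
      (\<Sum>j<m. row_col_sign m j * e j) + (\<Sum>j\<in>{m..<?N}. row_col_sign m j * e j)"
      by (simp only: sum.union_disjoint finite_lessThan finite_atLeastLessThan)
    also have "\<dots> = 0" using lt assms(2) by (simp add: row_col_sign_def e_def of_nat_diff)
    finally have e0: "(\<Sum>j<?N. row_col_sign m j * e j) = 0" .
    have "?S homeomorphic_space ball_top (?N - 2)"
      by (rule cone_section_ball[OF _ \<eta> _ _ _ e0]) (use assms(1,2) lt in \<open>auto simp: e_def\<close>)
    then show "real_top (vidx n) (remove_cone_points (revlex_tri (pt m) r (Pmn m n)) ((\<lambda>k. (k, k)) ` {1..i}))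
      homeomorphic_space ball_top (?N - 2)"
      using hom homeomorphic_space_trans by blast
  }
  assume "i = m \<and> m = n"
  \<comment> \<open>Every coordinate is now a difference \<open>x k - y k\<close>, so no sign
    constraint remains and the cone is the full hyperplane.\<close>
  then have N: "?N = n" "{i..<n} = {}" by auto
  have "?S homeomorphic_space (if n = 1 then trivial_topology else nsphere (n - 2))"
  proof (cases "n = 1")
    case True
    \<comment> \<open>For \<open>n = 1\<close> the equation forces \<open>u 0 = 0\<close>, against
      norm 2; the empty section is the sphere of dimension -1.\<close>
    then have "cone_section ?N (row_col_sign m) {i..<?N} = {}"
      unfolding N by (auto simp: cone_section_def hyperplane_cone_def row_col_sign_def)
    then show ?thesis using True by (simp add: homeomorphic_empty_space_eq)
  next
    case False
    then show ?thesis
      unfolding N using hyperplane_section_nsphere[of n "row_col_sign m"] \<eta> assms(1,3) by simp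
  qed
  then show "real_top (vidx n) (remove_cone_points (revlex_tri (pt m) r (Pmn m n)) ((\<lambda>k. (k, k)) ` {1..i}))
    homeomorphic_space (if n = 1 then trivial_topology else nsphere (n - 2))"
    using hom homeomorphic_space_trans by blast
qed

end
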